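(* Let $f:\mathbb{Z}^n\to\mathbb{R}\cup\{+\infty\}$ be a locally or globally discrete midpoint convex function with a bounded effective domain $\operatorname{dom} f$, let $K_\infty=\max\{\|x-y\|_\infty\mid x,y\in\operatorname{dom} f\}$, and assume $K_\infty>0$. Given $K_\infty$ and an initial point in $\operatorname{dom} f$, the scaling algorithm for discrete midpoint convex functions finds a minimizer of $f$ with $O(n\,F(n)\log_2K_\infty)$ function evaluations; that is, its output is a minimizer of $f$, and there is an absolute constant $C$ such that the number of function evaluations is at most $C\,n\,F(n)\log_2K_\infty$ whenever $K_\infty\ge2$.
   Context: For $x\in\mathbb{R}^n$, $\lceil x\rceil$ and $\lfloor x\rfloor$ denote the integer vectors obtained by rounding each component up, respectively down. $\operatorname{dom} f=\{x\in\mathbb{Z}^n\mid f(x)<+\infty\}$. A set $S\subseteq\mathbb{Z}^n$ is discrete midpoint convex if for all $x,y\in S$ with $\|x-y\|_\infty\ge2$ both $\lceil (x+y)/2\rceil$ and $\lfloor (x+y)/2\rfloor$ belong to $S$. Discrete midpoint convexity inequality for a pair $(x,y)$: $f(x)+f(y)\ge f(\lceil (x+y)/2\rceil)+f(\lfloor (x+y)/2\rfloor)$. $f$ is globally discrete midpoint convex if this inequality holds for all $x,y\in\mathbb{Z}^n$ with $\|x-y\|_\infty\ge2$. $f$ is locally discrete midpoint convex if $\operatorname{dom} f$ is a discrete midpoint convex set and the inequality holds for all $x,y\in\mathbb{Z}^n$ with $\|x-y\|_\infty=2$. Oracle: for $x\in\mathbb{Z}^n$ let $N_2(x)=\{y\in\mathbb{Z}^n\mid\|y-x\|_\infty\le2\}$.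 A 2-neighborhood minimization oracle finds, for a discrete midpoint convex function $g$ on $\mathbb{Z}^n$ and any $x\in\operatorname{dom} g$, a minimizer of $g$ in $N_2(x)$ intersected with a given box (integer interval). $F(n)\ge1$ denotes the number of function evaluations needed by the oracle (always $F(n)\le5^n$ can be achieved). The 2-neighborhood steepest descent algorithm for a function $g$ (with $S_k(y^{(0)})=\{y\in\mathbb{Z}^n\mid\|y-y^{(0)}\|_\infty\le k\}$): D0: Given $y^{(0)}\in\operatorname{dom} g$, find $y^{(2)}$ that minimizes $g$ in $S_2(y^{(0)})$, and set $k:=3$. D1: Find $y^{(k)}$ that minimizes $g$ in $N_2(y^{(k-1)})\cap S_k(y^{(0)})$. D2: If $g(y^{(k)})=g(y^{(k-1)})$, output $y^{(k-1)}$ and stop. D3: Set $k:=k+1$ and go to D1. Each minimization in D0 and D1 is one oracle call. Scaling algorithm for discrete midpoint convex functions: S0: Find a vector $x\in\operatorname{dom} f$ and set $\alpha:=2^{\lceil\log_2(K_\infty+1)\rceil}$. (The initial point $x$ and $K_\infty$ are assumed available at no cost.) S1: Find a vector $y$ that minimizes $f^\alpha(y)=f(x+\alpha y)$ subject to the constraint $\|y\|_\infty\le n$, by the 2-neighborhood steepest descent algorithm started at $y^{(0)}=\mathbf{0}$ (applied to $f^\alpha$ restricted to the box $\|y\|_\infty\le n$, i.e. with value $+\infty$ outside the box), and set $x:=x+\alpha y$. S2: If $\alpha=1$, then stop and output $x$. S3: Set $\alpha:=\alpha/2$, and go to S1. *)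

theory Defs
  imports Complex_Main "HOL-Library.Extended_Real"
begin

text \<open>
  The dimension \<open>n\<close> is a number rather than a type, because the complexity bound involves a constant
  that is uniform in \<open>n\<close>. A point of \<open>Z^n\<close> is a function \<open>nat \<Rightarrow> int\<close> that vanishes outside \<open>{..<n}\<close>.
\<close>

type_synonym point = "nat \<Rightarrow> int"

definition Zn :: "nat \<Rightarrow> point set" where
  "Zn n = {x. \<forall>i\<ge>n. x i = 0}"

definition linf :: "nat \<Rightarrow> point \<Rightarrow> int" where
  "linf n x = Max (insert 0 ((\<lambda>i. \<bar>x i\<bar>) ` {..<n}))"

definition mid_up :: "point \<Rightarrow> point \<Rightarrow> point" where
  "mid_up x y = (\<lambda>i. \<lceil>(real_of_int (x i) + real_of_int (y i)) / 2\<rceil>)"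

definition mid_down :: "point \<Rightarrow> point \<Rightarrow> point" where
  "mid_down x y = (\<lambda>i. \<lfloor>(real_of_int (x i) + real_of_int (y i)) / 2\<rfloor>)"


text \<open>
  Functions from \<open>Z^n\<close> to the reals with \<open>+\<infinity>\<close>. Values at points outside \<^term>\<open>Zn n\<close> are irrelevant.
\<close>

definition no_neg_infinity :: "nat \<Rightarrow> (point \<Rightarrow> ereal) \<Rightarrow> bool" where
  "no_neg_infinity n f \<longleftrightarrow> (\<forall>x\<in>Zn n. f x \<noteq> -\<infinity>)"

definition effdom :: "nat \<Rightarrow> (point \<Rightarrow> ereal) \<Rightarrow> point set" where
  "effdom n f = {x \<in> Zn n. f x < \<infinity>}"

definition dmc_set :: "nat \<Rightarrow> point set \<Rightarrow> bool" where
  "dmc_set n S \<longleftrightarrow> (\<forall>x\<in>S. \<forall>y\<in>S. linf n (x - y) \<ge> 2 \<longrightarrow> mid_up x y \<in> S \<and> mid_down x y \<in> S)"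

definition dmc_ineq :: "(point \<Rightarrow> ereal) \<Rightarrow> point \<Rightarrow> point \<Rightarrow> bool" where
  "dmc_ineq f x y \<longleftrightarrow> f x + f y \<ge> f (mid_up x y) + f (mid_down x y)"

definition globally_dmc :: "nat \<Rightarrow> (point \<Rightarrow> ereal) \<Rightarrow> bool" where
  "globally_dmc n f \<longleftrightarrow> no_neg_infinity n f \<and>
     (\<forall>x\<in>Zn n. \<forall>y\<in>Zn n. linf n (x - y) \<ge> 2 \<longrightarrow> dmc_ineq f x y)"

definition locally_dmc :: "nat \<Rightarrow> (point \<Rightarrow> ereal) \<Rightarrow> bool" where
  "locally_dmc n f \<longleftrightarrow> no_neg_infinity n f \<and> dmc_set n (effdom n f) \<and>
     (\<forall>x\<in>Zn n. \<forall>y\<in>Zn n. linf n (x - y) = 2 \<longrightarrow> dmc_ineq f x y)"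

definition bounded_effdom :: "nat \<Rightarrow> (point \<Rightarrow> ereal) \<Rightarrow> bool" where
  "bounded_effdom n f \<longleftrightarrow> (\<exists>B. \<forall>x\<in>effdom n f. linf n x \<le> B)"

definition Kinf :: "nat \<Rightarrow> (point \<Rightarrow> ereal) \<Rightarrow> int" where
  "Kinf n f = Max {linf n (x - y) | x y. x \<in> effdom n f \<and> y \<in> effdom n f}"


text \<open>
  A procedure with access to a function only through evaluations is an adaptive query program: it
  either returns a result, or asks for the value at a point and continues depending on the answer.
  \<open>evals g p\<close> is the number of evaluations of \<open>g\<close> made by \<open>p\<close>.
\<close>

datatype query_prog = Return point | Query point "ereal \<Rightarrow> query_prog"

primrec answer :: "(point \<Rightarrow> ereal) \<Rightarrow> query_prog \<Rightarrow> point" where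
  "answer g (Return y) = y"
| "answer g (Query z p) = answer g (p (g z))"

primrec evals :: "(point \<Rightarrow> ereal) \<Rightarrow> query_prog \<Rightarrow> nat" where
  "evals g (Return y) = 0"
| "evals g (Query z p) = Suc (evals g (p (g z)))"

definition cube :: "nat \<Rightarrow> point \<Rightarrow> int \<Rightarrow> point set" where
  "cube n x k = {y \<in> Zn n. linf n (y - x) \<le> k}"

definition integer_interval :: "nat \<Rightarrow> point set \<Rightarrow> bool" where
  "integer_interval n B \<longleftrightarrow> (\<exists>a b. B = {y \<in> Zn n. \<forall>i<n. a i \<le> y i \<and> y i \<le> b i})"

type_synonym nbhd_oracle = "point \<Rightarrow> point set \<Rightarrow> query_prog"

text \<open>
  \<open>orc x B\<close> finds a minimizer over \<open>N_2(x) \<inter> B\<close> for every discrete midpoint convex function,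
  with at most \<open>m\<close> evaluations. If \<open>N_2(x) \<inter> B\<close> is empty there is no minimizer to be found.
\<close>

definition two_nbhd_oracle :: "nat \<Rightarrow> nat \<Rightarrow> nbhd_oracle \<Rightarrow> bool" where
  "two_nbhd_oracle n m orc \<longleftrightarrow>
     (\<forall>g x B. (locally_dmc n g \<or> globally_dmc n g) \<and> x \<in> effdom n g \<and>
        integer_interval n B \<and> cube n x 2 \<inter> B \<noteq> {} \<longrightarrow>
        is_arg_min g (\<lambda>y. y \<in> cube n x 2 \<inter> B) (answer g (orc x B)) \<and>
        evals g (orc x B) \<le> m)"


text \<open>
  The algorithms are given as big-step relations between input, output and number of function
  evaluations. They are deterministic, since the oracle is a function and the rules exclude each
  other; a non-terminating run has no output. In \<open>descent_loop n orc g y0 k y z N\<close> the point \<open>y\<close>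
  is the iterate \<open>y^(k-1)\<close>. The test \<open>g y' = g y\<close> is charged two evaluations on top of those made
  by the oracle.
\<close>

inductive descent_loop ::
  "nat \<Rightarrow> nbhd_oracle \<Rightarrow> (point \<Rightarrow> ereal) \<Rightarrow> point \<Rightarrow> nat \<Rightarrow> point \<Rightarrow> point \<Rightarrow> nat \<Rightarrow> bool"
  for n orc g y0 where
  stop: "y' = answer g (orc y (cube n y0 (int k))) \<Longrightarrow> g y' = g y \<Longrightarrow>
     descent_loop n orc g y0 k y y (evals g (orc y (cube n y0 (int k))) + 2)"
| continue: "y' = answer g (orc y (cube n y0 (int k))) \<Longrightarrow> g y' \<noteq> g y \<Longrightarrow>
     descent_loop n orc g y0 (k + 1) y' z N \<Longrightarrow>
     descent_loop n orc g y0 k y z (evals g (orc y (cube n y0 (int k))) + 2 + N)"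

definition steepest_descent ::
  "nat \<Rightarrow> nbhd_oracle \<Rightarrow> (point \<Rightarrow> ereal) \<Rightarrow> point \<Rightarrow> point \<Rightarrow> nat \<Rightarrow> bool" where
  "steepest_descent n orc g y0 z N \<longleftrightarrow>
     (\<exists>N'. descent_loop n orc g y0 3 (answer g (orc y0 (cube n y0 2))) z N' \<and>
           N = evals g (orc y0 (cube n y0 2)) + N')"

definition move :: "point \<Rightarrow> int \<Rightarrow> point \<Rightarrow> point" where
  "move x \<alpha> y = (\<lambda>i. x i + \<alpha> * y i)"

text \<open>
  The function \<open>f^\<alpha>\<close>, restricted to the box of radius \<open>n\<close>. Each evaluation of it takes at most one
  evaluation of \<open>f\<close>, and is counted as one.
\<close>

definition scaled_fun :: "nat \<Rightarrow> (point \<Rightarrow> ereal) \<Rightarrow> point \<Rightarrow> int \<Rightarrow> point \<Rightarrow> ereal" where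
  "scaled_fun n f x \<alpha> y = (if linf n y \<le> int n then f (move x \<alpha> y) else \<infinity>)"

inductive scaling_loop ::
  "nat \<Rightarrow> nbhd_oracle \<Rightarrow> (point \<Rightarrow> ereal) \<Rightarrow> point \<Rightarrow> int \<Rightarrow> point \<Rightarrow> nat \<Rightarrow> bool"
  for n orc f where
  stop: "\<alpha> = 1 \<Longrightarrow> steepest_descent n orc (scaled_fun n f x \<alpha>) (\<lambda>_. 0) y N \<Longrightarrow>
     scaling_loop n orc f x \<alpha> (move x \<alpha> y) N"
| continue: "\<alpha> \<noteq> 1 \<Longrightarrow> steepest_descent n orc (scaled_fun n f x \<alpha>) (\<lambda>_. 0) y N \<Longrightarrow>
     scaling_loop n orc f (move x \<alpha> y) (\<alpha> div 2) z N' \<Longrightarrow>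
     scaling_loop n orc f x \<alpha> z (N + N')"

definition scaling_algorithm ::
  "nat \<Rightarrow> nbhd_oracle \<Rightarrow> (point \<Rightarrow> ereal) \<Rightarrow> point \<Rightarrow> point \<Rightarrow> nat \<Rightarrow> bool" where
  "scaling_algorithm n orc f x z N \<longleftrightarrow>
     scaling_loop n orc f x (2 ^ nat \<lceil>log 2 (real_of_int (Kinf n f + 1))\<rceil>) z N"

end

theory Submission
  imports Defs
begin

text \<open>
  Write the difference \<open>d = y - x\<close> of two points at distance \<open>m\<close> as a sum of \<open>m\<close> vectors with entries
  in \<open>{-1, 0, 1}\<close>. The \<open>k\<close>-th of these layers has a \<open>1\<close> where \<open>d i \<ge> m + 1 - k\<close> and a \<open>-1\<close> where
  \<open>d i \<le> - k\<close>, so the positive parts grow with \<open>k\<close> while the negative parts shrink. With this ordering,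
  the rounded midpoints of \<open>p\<close> and \<open>p + d\<^sub>k + d\<^sub>l\<close> are exactly \<open>p + d\<^sub>k\<close> and \<open>p + d\<^sub>l\<close>, and these two
  end points always have distance 2, because the coordinate where \<open>\<bar>d i\<bar> = m\<close> takes part in every
  layer. Local discrete midpoint convexity therefore says that \<open>J \<mapsto> f (x + (\<Sum>k\<in>J. d\<^sub>k))\<close> is locally
  supermodular on subsets of \<open>{1..m}\<close>. Local supermodularity of a finite function is global, which gives
  the exchange inequality
  \<open>f x + f y \<ge> f (x + (\<Sum>k\<in>J. d\<^sub>k)) + f (y - (\<Sum>k\<in>J. d\<^sub>k))\<close> for every \<open>J\<close> (\<open>locally_dmc_exchange\<close>). That the
  function is finite at all these points is a property of discrete midpoint convex sets
  (\<open>dmc_set_walk\<close>), and the only step where midpoints of distant points have to be used.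
  
  Everything about the algorithms follows from three choices of \<open>J\<close>.
  
  \<^item> \<open>J = {1}\<close>: a minimizer among the points at distance at most 1 is a global minimizer
  (\<open>local_minimum_is_global\<close>), so the descent is right to stop when the value does not drop.
  
  \<^item> \<open>J = {1, m}\<close>: these two layers move every coordinate in which \<open>x\<close> and \<open>y\<close> differ, and by at most 2.
  If \<open>y\<close> is optimal in a ball, one minimization over its 2-neighbourhood is therefore enough to be
  optimal in the ball whose radius is larger by 1 (\<open>ball_cube_step\<close>). Hence the descent restricted to
  the box of radius \<open>n\<close> stops after at most about \<open>n\<close> steps.
  
  \<^item> \<open>J = {k, k + 1}\<close> for two equal layers: if 0 is optimal on \<open>2 Z^n\<close>, some minimizer lies in the box
  of radius \<open>n\<close> (\<open>scaling_proximity\<close>). Two neighbouring layers differ only if some coordinate \<open>i\<close> has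
  \<open>d i = m - k\<close> or \<open>d i = - k\<close>, so beyond distance \<open>n\<close> two of them coincide and
  can be moved from the minimizer to 0 together, as an even vector.
  
  The function \<open>y \<mapsto> f (x + \<alpha> y)\<close> is again locally discrete midpoint convex for powers of two
  (\<open>locally_dmc_double\<close>), which makes all of this applicable in every round. The initial step size exceeds
  \<open>K\<close>, so the initial point is trivially optimal at twice that step size; each round turns optimality at step size
  \<open>2 \<alpha>\<close> into optimality at step size \<open>\<alpha>\<close>. There are about \<open>log K\<close> rounds of at most \<open>4 n F(n)\<close>
  evaluations each.
\<close>

section \<open>The maximum norm and midpoints\<close>

lemma linf_le_iff: "0 \<le> k \<Longrightarrow> linf n x \<le> k \<longleftrightarrow> (\<forall>i<n. \<bar>x i\<bar> \<le> k)"
  unfolding linf_def by (subst Max_le_iff) auto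

lemma linf_ge_iff: "0 < k \<Longrightarrow> k \<le> linf n x \<longleftrightarrow> (\<exists>i<n. k \<le> \<bar>x i\<bar>)"
  unfolding linf_def by (subst Max_ge_iff) auto

lemma linf_nonneg: "0 \<le> linf n x"
  unfolding linf_def by (subst Max_ge_iff) auto

lemma abs_le_linf: "i < n \<Longrightarrow> \<bar>x i\<bar> \<le> linf n x"
  using linf_le_iff[OF linf_nonneg, of n x n x] by auto

lemma linf_attained:
  assumes "0 < linf n x"
  obtains i where "i < n" "\<bar>x i\<bar> = linf n x"
  using linf_ge_iff[OF assms, of n x] abs_le_linf[of _ n x] by (metis order.antisym order.refl)

lemma linf_eqI:
  assumes "\<And>i. i < n \<Longrightarrow> \<bar>x i\<bar> \<le> k" "j < n" "\<bar>x j\<bar> = k"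
  shows "linf n x = k"
proof (rule order.antisym)
  have "0 \<le> k" using assms(3) by linarith
  then show "linf n x \<le> k" using assms(1) by (simp add: linf_le_iff)
  show "k \<le> linf n x" using abs_le_linf[OF assms(2), of x] assms(3) by simp
qed

lemma linf_commute: "linf n (x - y) = linf n (y - x)"
  unfolding linf_def by (simp add: abs_minus_commute)

lemma mid_up_div: "mid_up x y i = (x i + y i + 1) div 2"
proof -
  have "\<lceil>(real_of_int (x i) + real_of_int (y i)) / 2\<rceil> = (x i + y i + 1) div 2"
    by (rule ceiling_unique; cases "even (x i + y i)") (auto elim!: evenE oddE)
  then show ?thesis by (simp add: mid_up_def)
qed

lemma mid_down_div: "mid_down x y i = (x i + y i) div 2"
proof -
  have "\<lfloor>(real_of_int (x i) + real_of_int (y i)) / 2\<rfloor> = (x i + y i) div 2"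
    by (rule floor_unique; cases "even (x i + y i)") (auto elim!: evenE oddE)
  then show ?thesis by (simp add: mid_down_def)
qed

lemma mid_in_Zn: "x \<in> Zn n \<Longrightarrow> y \<in> Zn n \<Longrightarrow> mid_up x y \<in> Zn n \<and> mid_down x y \<in> Zn n"
  by (simp add: Zn_def mid_up_div mid_down_div)


section \<open>Layers of a difference vector\<close>

text \<open>
  The threshold \<open>m + 1 - k\<close> for positive entries runs against the threshold \<open>k\<close> for negative ones. This
  is what makes consecutive rounding up and down split a difference into layers: \<open>\<lceil>(-1) / 2\<rceil> = 0\<close> but
  \<open>\<lceil>1 / 2\<rceil> = 1\<close>.
\<close>

definition layer :: "int \<Rightarrow> point \<Rightarrow> int \<Rightarrow> point" where
  "layer m d k = (\<lambda>i. if d i \<ge> m + 1 - k then 1 else if d i \<le> - k then -1 else 0)"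

text \<open>
  The properties of the layers of a vector that survive the passage to an arbitrary subset of the
  layers. The last clause forces the sum over any set of layers to have a norm equal to
  their number.
\<close>

definition layered :: "nat \<Rightarrow> int set \<Rightarrow> (int \<Rightarrow> point) \<Rightarrow> bool" where
  "layered n K e \<longleftrightarrow> finite K \<and> (\<forall>k\<in>K. e k \<in> Zn n) \<and> (\<forall>k\<in>K. \<forall>i. \<bar>e k i\<bar> \<le> 1) \<and>
     (\<forall>k\<in>K. \<forall>l\<in>K. \<forall>i. k \<le> l \<longrightarrow> e k i \<le> e l i) \<and>
     (\<forall>k\<in>K. \<forall>l\<in>K. \<forall>i. e k i = 1 \<longrightarrow> e l i \<noteq> -1) \<and>
     (K \<noteq> {} \<longrightarrow> (\<exists>i<n. (\<forall>k\<in>K. e k i = 1) \<or> (\<forall>k\<in>K. e k i = -1)))"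

definition walk :: "point \<Rightarrow> (int \<Rightarrow> point) \<Rightarrow> int set \<Rightarrow> point" where
  "walk x e J = (\<lambda>i. x i + (\<Sum>k\<in>J. e k i))"

lemma walk_empty [simp]: "walk x e {} = x"
  by (simp add: walk_def)

lemma walk_union:
  "finite I \<Longrightarrow> finite J \<Longrightarrow> I \<inter> J = {} \<Longrightarrow> walk (walk x e I) e J = walk x e (I \<union> J)"
  by (simp add: walk_def sum.union_disjoint add.assoc)

lemma layered_subset: "layered n K e \<Longrightarrow> J \<subseteq> K \<Longrightarrow> layered n J e"
  unfolding layered_def subset_iff by (meson finite_subset subsetI ex_in_conv)

lemma sum_unit_le_card:
  fixes e :: "int \<Rightarrow> int"
  assumes "\<And>k. k \<in> K \<Longrightarrow> \<bar>e k\<bar> \<le> 1"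
  shows "\<bar>\<Sum>k\<in>K. e k\<bar> \<le> int (card K)"
proof -
  have "\<bar>\<Sum>k\<in>K. e k\<bar> \<le> (\<Sum>k\<in>K. \<bar>e k\<bar>)" by (rule sum_abs)
  also have "\<dots> \<le> (\<Sum>k\<in>K. 1)" using assms by (intro sum_mono) auto
  finally show ?thesis by simp
qed

lemma linf_walk:
  assumes "layered n K e"
  shows "linf n (walk x e K - x) = int (card K)"
proof (cases "K = {}")
  case True
  then show ?thesis
    using linf_le_iff[of 0 n "walk x e K - x"] linf_nonneg[of n "walk x e K - x"] by simp
next
  case False
  then obtain j where j: "j < n" "(\<forall>k\<in>K. e k j = 1) \<or> (\<forall>k\<in>K. e k j = -1)"
    using assms unfolding layered_def by auto
  show ?thesis
  proof (rule linf_eqI[OF _ j(1)])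
    show "\<bar>(walk x e K - x) i\<bar> \<le> int (card K)" for i
      using assms sum_unit_le_card[of K "\<lambda>k. e k i"] by (simp add: walk_def layered_def)
    show "\<bar>(walk x e K - x) j\<bar> = int (card K)"
      using j(2) by (auto simp: walk_def)
  qed
qed

lemma sum_layer:
  assumes "\<bar>d i\<bar> \<le> m"
  shows "(\<Sum>k\<in>{1..m}. layer m d k i) = d i"
proof (cases "d i \<ge> 0")
  case True
  have "(\<Sum>k\<in>{1..m}. layer m d k i) = (\<Sum>k\<in>{1..m}. if k \<in> {m + 1 - d i..m} then 1 else 0)"
    using True by (intro sum.cong) (auto simp: layer_def)
  also have "\<dots> = int (card ({1..m} \<inter> {m + 1 - d i..m}))"
    by (subst sum.inter_restrict[symmetric]) simp_all
  also have "{1..m} \<inter> {m + 1 - d i..m} = {m + 1 - d i..m}" using assms by auto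
  finally show ?thesis using True by simp
next
  case False
  have "(\<Sum>k\<in>{1..m}. layer m d k i) = (\<Sum>k\<in>{1..m}. if k \<in> {1..- d i} then -1 else 0)"
    using False by (intro sum.cong) (auto simp: layer_def)
  also have "\<dots> = - int (card ({1..m} \<inter> {1..- d i}))"
    by (subst sum.inter_restrict[symmetric]) auto
  also have "{1..m} \<inter> {1..- d i} = {1..- d i}" using assms by auto
  finally show ?thesis using False by simp
qed

lemma layered_layer:
  assumes "d \<in> Zn n" "linf n d = m"
  shows "layered n {1..m} (layer m d)"
proof -
  have "\<exists>i<n. (\<forall>k\<in>{1..m}. layer m d k i = 1) \<or> (\<forall>k\<in>{1..m}. layer m d k i = -1)" if "{1..m} \<noteq> {}"
  proof -
    have "0 < m" using that by auto
    then obtain i where i: "i < n" "\<bar>d i\<bar> = m" using linf_attained[of n d] assms(2) by auto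
    then show ?thesis using \<open>0 < m\<close> by (intro exI[of _ i]) (auto simp: layer_def abs_if split: if_splits)
  qed
  then show ?thesis
    using assms(1) unfolding layered_def by (auto simp: layer_def Zn_def)
qed

lemma walk_layer:
  assumes "x \<in> Zn n" "y \<in> Zn n" "linf n (y - x) = m"
  shows "walk x (layer m (y - x)) {1..m} = y"
proof
  fix i
  have "\<bar>(y - x) i\<bar> \<le> m"
    using abs_le_linf[of i n "y - x"] assms linf_nonneg[of n "y - x"]
    by (cases "i < n") (auto simp: Zn_def)
  then show "walk x (layer m (y - x)) {1..m} i = y i"
    by (simp add: walk_def sum_layer)
qed

lemma diff_in_Zn: "x \<in> Zn n \<Longrightarrow> y \<in> Zn n \<Longrightarrow> y - x \<in> Zn n"
  by (simp add: Zn_def)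

text \<open>
  In each coordinate the layers \<open>k < l\<close> agree or the later one is larger by 1. Rounding half of their sum
  down and up thus returns the two layers.
\<close>

lemma mid_walk_pair:
  assumes "layered n {k, l} e" "k < l"
  shows "mid_up x (walk x e {k, l}) = walk x e {l}" "mid_down x (walk x e {k, l}) = walk x e {k}"
proof -
  have *: "e k i \<le> e l i" "\<bar>e k i\<bar> \<le> 1" "\<bar>e l i\<bar> \<le> 1" "\<not> (e k i = -1 \<and> e l i = 1)" for i
    using assms unfolding layered_def by auto
  have step: "e l i = e k i \<or> e l i = e k i + 1" for i using *[of i] by linarith
  have up: "(x i + (x i + (e k i + e l i)) + 1) div 2 = x i + e l i" for i
    using step[of i] by presburger
  have down: "(x i + (x i + (e k i + e l i))) div 2 = x i + e k i" for i
    using step[of i] by presburger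
  show "mid_up x (walk x e {k, l}) = walk x e {l}"
  proof
    show "mid_up x (walk x e {k, l}) i = walk x e {l} i" for i
      using up[of i] assms(2) by (simp add: mid_up_div walk_def)
  qed
  show "mid_down x (walk x e {k, l}) = walk x e {k}"
  proof
    show "mid_down x (walk x e {k, l}) i = walk x e {k} i" for i
      using down[of i] assms(2) by (simp add: mid_down_div walk_def)
  qed
qed


section \<open>Discrete midpoint convex sets\<close>

text \<open>
  An arbitrary family of layers is recognized from its sum. Only its extreme members
  are needed: the first one has a \<open>1\<close> only where all members do, and a \<open>-1\<close> wherever some member does.
\<close>

lemma layered_first:
  assumes "layered n K e" "K \<noteq> {}" "linf n (walk x e K - x) = m"
  shows "e (Min K) = layer m (walk x e K - x) 1"
proof
  fix i
  have K: "finite K" "Min K \<in> K" "\<And>k. k \<in> K \<Longrightarrow> e (Min K) i \<le> e k i"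
    "\<And>k. k \<in> K \<Longrightarrow> \<bar>e k i\<bar> \<le> 1" "\<And>k l. k \<in> K \<Longrightarrow> l \<in> K \<Longrightarrow> \<not> (e k i = 1 \<and> e l i = -1)"
    using assms(1,2) unfolding layered_def by auto
  have m: "m = int (card K)" using linf_walk[OF assms(1)] assms(3) by auto
  have "0 < m" using K(1) assms(2) by (simp add: m card_gt_0_iff)
  have d: "walk x e K i - x i = (\<Sum>k\<in>K. e k i)" by (simp add: walk_def)
  consider "e (Min K) i = 1" | "e (Min K) i = 0" | "e (Min K) i = -1" using K(4)[OF K(2)] by linarith
  then show "e (Min K) i = layer m (walk x e K - x) 1 i"
  proof cases
    case 1
    then have "\<And>k. k \<in> K \<Longrightarrow> e k i = 1" using K(3,4) by force
    then have "(\<Sum>k\<in>K. e k i) = m" by (simp add: m)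
    with 1 show ?thesis by (simp add: layer_def d)
  next
    case 2
    then have "0 \<le> (\<Sum>k\<in>K. e k i)" using K(3) by (intro sum_nonneg) auto
    moreover have "(\<Sum>k\<in>K. e k i) < (\<Sum>k\<in>K. 1)"
      using 2 K by (intro sum_strict_mono_ex1) (auto intro!: bexI[of _ "Min K"] simp: abs_le_iff)
    ultimately show ?thesis using 2 by (simp add: layer_def d m)
  next
    case 3
    then have "e k i \<le> 0" if "k \<in> K" for k using K(4,5) K(2) that by force
    then have "(\<Sum>k\<in>K. e k i) < (\<Sum>k\<in>K. 0)"
      using 3 K(1,2) by (intro sum_strict_mono_ex1) (auto intro!: bexI[of _ "Min K"])
    then show ?thesis using 3 \<open>0 < m\<close> by (simp add: layer_def d)
  qed
qed

lemma layered_last: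
  assumes "layered n K e" "K \<noteq> {}" "linf n (walk x e K - x) = m"
  shows "e (Max K) = layer m (walk x e K - x) m"
proof
  fix i
  have K: "finite K" "Max K \<in> K" "\<And>k. k \<in> K \<Longrightarrow> e k i \<le> e (Max K) i"
    "\<And>k. k \<in> K \<Longrightarrow> \<bar>e k i\<bar> \<le> 1" "\<And>k l. k \<in> K \<Longrightarrow> l \<in> K \<Longrightarrow> \<not> (e k i = 1 \<and> e l i = -1)"
    using assms(1,2) unfolding layered_def by auto
  have m: "m = int (card K)" using linf_walk[OF assms(1)] assms(3) by auto
  have "0 < m" using K(1) assms(2) by (simp add: m card_gt_0_iff)
  have d: "walk x e K i - x i = (\<Sum>k\<in>K. e k i)" by (simp add: walk_def)
  consider "e (Max K) i = 1" | "e (Max K) i = 0" | "e (Max K) i = -1" using K(4)[OF K(2)] by linarith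
  then show "e (Max K) i = layer m (walk x e K - x) m i"
  proof cases
    case 1
    then have "0 \<le> e k i" if "k \<in> K" for k using K(4,5) K(2) that by force
    then have "(\<Sum>k\<in>K. 0) < (\<Sum>k\<in>K. e k i)"
      using 1 K(1,2) by (intro sum_strict_mono_ex1) (auto intro!: bexI[of _ "Max K"])
    with 1 show ?thesis by (simp add: layer_def d)
  next
    case 2
    then have "(\<Sum>k\<in>K. e k i) \<le> 0" using K(3) by (intro sum_nonpos) auto
    moreover have "(\<Sum>k\<in>K. -1) < (\<Sum>k\<in>K. e k i)"
      using 2 K by (intro sum_strict_mono_ex1) (auto intro!: bexI[of _ "Max K"] simp: abs_le_iff)
    ultimately show ?thesis using 2 by (simp add: layer_def d m)
  next
    case 3
    then have "\<And>k. k \<in> K \<Longrightarrow> e k i = -1" using K(3,4) by force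
    then have "(\<Sum>k\<in>K. e k i) = - m" by (simp add: m)
    with 3 \<open>0 < m\<close> show ?thesis by (simp add: layer_def d)
  qed
qed

definition shift :: "point \<Rightarrow> point \<Rightarrow> point" where
  "shift x d = (\<lambda>i. x i + d i)"

lemma walk_single: "walk x e {k} = shift x (e k)"
  by (simp add: walk_def shift_def)

text \<open>
  The difficulty is that for odd \<open>m\<close> the midpoints of \<open>x\<close> and \<open>y\<close> are not sums of layers of \<open>y - x\<close>: the
  positive and the negative entries use different layers. They are nevertheless at distance
  \<open>\<lceil>m / 2\<rceil> < m\<close> from \<open>x\<close> or \<open>y\<close> and have layers of their own, which an induction on the distance makes available; some of
  these coincide with an extreme layer of \<open>y - x\<close>. Which ones do depends on the signs that attain the
  maximum \<open>m\<close> and on the parity of \<open>m\<close>.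
\<close>

lemma dmc_set_first_or_last:
  assumes S: "S \<subseteq> Zn n" "dmc_set n S" and xy: "x \<in> S" "y \<in> S" "linf n (y - x) = m" "2 \<le> m"
    and shorter: "\<And>x y p. x \<in> S \<Longrightarrow> y \<in> S \<Longrightarrow> linf n (y - x) = p \<Longrightarrow> 0 < p \<Longrightarrow> p < m \<Longrightarrow>
      shift x (layer p (y - x) 1) \<in> S \<and> shift x (layer p (y - x) p) \<in> S"
  shows "shift x (layer m (y - x) 1) \<in> S \<or> shift x (layer m (y - x) m) \<in> S"
proof -
  define d where "d = y - x"
  define u where "u = mid_up x y"
  define v where "v = mid_down x y"
  define p where "p = (m + 1) div 2"
  have y: "y i = x i + d i" for i by (simp add: d_def)
  have u: "(u - x) i = (d i + 1) div 2" for i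
  proof -
    have "x i + y i + 1 = d i + 1 + x i * 2" by (simp add: y)
    then show ?thesis by (simp add: u_def mid_up_div)
  qed
  have v: "(v - x) i = d i div 2" for i
  proof -
    have "x i + y i = d i + x i * 2" by (simp add: y)
    then show ?thesis by (simp add: v_def mid_down_div)
  qed
  have uv: "u \<in> S" "v \<in> S"
    using S(2) xy unfolding dmc_set_def u_def v_def by (metis linf_commute)+
  have le: "\<bar>d i\<bar> \<le> m" if "i < n" for i using abs_le_linf[OF that, of "y - x"] xy(3) by (simp add: d_def)
  obtain j where j: "j < n" "\<bar>d j\<bar> = m" using linf_attained[of n "y - x"] xy(3,4) by (auto simp: d_def)
  have p: "0 < p" "p < m" using xy(4) by (auto simp: p_def)
  have d0: "d i = 0" if "\<not> i < n" for i
    using subsetD[OF S(1) xy(1)] subsetD[OF S(1) xy(2)] that by (simp add: d_def Zn_def)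
  show ?thesis
  proof (cases "\<exists>i<n. d i = -m")
    case no_bottom: False
    \<comment> \<open>The negative entries are strictly smaller than \<open>m\<close> in modulus, and remain strictly below the maximum
      when the upper midpoint rounds them towards 0. The last layers of \<open>u - x\<close> and of \<open>y - x\<close> then both
      are the indicator of the positive entries.\<close>
    have neg: "- d i < m" if "i < n" for i using le[OF that] no_bottom that by force
    have "linf n (u - x) = p"
    proof (rule linf_eqI[OF _ j(1)])
      show "\<bar>(u - x) i\<bar> \<le> p" if "i < n" for i
        using le[OF that] unfolding u p_def by (auto simp: abs_le_iff)
      have "d j = m" using j no_bottom by (auto simp: abs_if split: if_splits)
      then show "\<bar>(u - x) j\<bar> = p" unfolding u p_def using xy(4) by simp
    qed
    then have "shift x (layer p (u - x) p) \<in> S" using shorter xy(1) uv(1) p by blast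
    moreover have "layer p (u - x) p = layer m d m"
    proof
      fix i
      show "layer p (u - x) p i = layer m d m i"
      proof (cases "i < n")
        case True
        have "1 \<le> (d i + 1) div 2 \<longleftrightarrow> 1 \<le> d i" by presburger
        moreover have "\<not> (d i + 1) div 2 \<le> - p" using neg[OF True] unfolding p_def by presburger
        moreover have "\<not> d i \<le> - m" using neg[OF True] by simp
        ultimately show ?thesis unfolding layer_def u by simp
      qed (use p xy(4) u[of i] d0[of i] in \<open>simp add: layer_def\<close>)
    qed
    ultimately show ?thesis by (simp add: d_def)
  next
    case bottom: True
    then obtain b where b: "b < n" "d b = -m" by blast
    show ?thesis
    proof (cases "(\<exists>i<n. d i = m) \<and> odd m")
      case False
      \<comment> \<open>An entry \<open>m\<close> of \<open>y - x\<close> becomes \<open>p\<close> in \<open>v - x\<close> for even \<open>m\<close> but only \<open>p - 1\<close> for odd \<open>m\<close>;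
        in the latter case there is no such entry. Smaller entries stay below \<open>p\<close> either way.\<close>
      have "linf n (v - x) = p"
      proof (rule linf_eqI[OF _ b(1)])
        show "\<bar>(v - x) i\<bar> \<le> p" if "i < n" for i
          using le[OF that] unfolding v p_def by (auto simp: abs_le_iff)
        show "\<bar>(v - x) b\<bar> = p" unfolding v p_def b using xy(4) by presburger
      qed
      then have "shift x (layer p (v - x) 1) \<in> S" using shorter xy(1) uv(2) p by blast
      moreover have "layer p (v - x) 1 = layer m d 1"
      proof
        fix i
        show "layer p (v - x) 1 i = layer m d 1 i"
        proof (cases "i < n")
          case True
          have "p \<le> d i div 2 \<longleftrightarrow> m \<le> d i"
          proof (cases "odd m")
            case True
            then have "d i < m" using le[OF \<open>i < n\<close>] False \<open>i < n\<close> by force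
            then show ?thesis unfolding p_def by presburger
          next
            case False
            then show ?thesis unfolding p_def by presburger
          qed
          moreover have "d i div 2 \<le> -1 \<longleftrightarrow> d i \<le> -1" by presburger
          ultimately show ?thesis unfolding layer_def v by simp
        qed (use p xy(4) v[of i] d0[of i] in \<open>simp add: layer_def\<close>)
      qed
      ultimately show ?thesis by (simp add: d_def)
    next
      case True
      then obtain t where t: "t < n" "d t = m" and "odd m" by blast
      \<comment> \<open>Both signs attain the odd maximum. The point \<open>w\<close> is the upper midpoint corrected by the first
        layer of the way from there to \<open>y\<close>: this lowers every coordinate in which \<open>y\<close> is below \<open>x\<close> and no other, so that
        the negative entries, which \<open>u\<close> rounds towards 0, are all present again in \<open>w - x\<close>.\<close>
      then have m: "m = 2 * p - 1" unfolding p_def by presburger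
      have yu: "(y - u) i = d i div 2" for i
      proof -
        have "(y - u) i = d i - (u - x) i" by (simp add: d_def)
        also have "\<dots> = d i div 2" unfolding u by presburger
        finally show ?thesis .
      qed
      have "linf n (y - u) = p"
      proof (rule linf_eqI[OF _ b(1)])
        show "\<bar>(y - u) i\<bar> \<le> p" if "i < n" for i
          using le[OF that] unfolding yu p_def by (auto simp: abs_le_iff)
        show "\<bar>(y - u) b\<bar> = p" unfolding yu p_def b using xy(4) by presburger
      qed
      moreover define w where "w = shift u (layer p (y - u) 1)"
      ultimately have "w \<in> S" using shorter uv(1) xy(2) p by blast
      have w: "(w - x) i = (if d i \<le> -1 then (d i + 1) div 2 - 1 else (d i + 1) div 2)" for i
      proof -
        have "\<bar>d i\<bar> \<le> m" using le[of i] d0[of i] xy(4) by (cases "i < n") auto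
        then have "\<not> p \<le> d i div 2" unfolding m by presburger
        moreover have "d i div 2 \<le> -1 \<longleftrightarrow> d i \<le> -1" by presburger
        moreover have "(w - x) i = (u - x) i + layer p (y - u) 1 i" by (simp add: w_def shift_def)
        ultimately show ?thesis unfolding layer_def yu u by simp
      qed
      have "linf n (w - x) = p"
      proof (rule linf_eqI[OF _ t(1)])
        show "\<bar>(w - x) i\<bar> \<le> p" if "i < n" for i
          using le[OF that] unfolding w m by (auto simp: abs_le_iff)
        show "\<bar>(w - x) t\<bar> = p" unfolding w t m using p by simp
      qed
      then have "shift x (layer p (w - x) 1) \<in> S" using shorter xy(1) \<open>w \<in> S\<close> p by blast
      moreover have "layer p (w - x) 1 = layer m d 1"
      proof
        fix i
        have "p \<le> (w - x) i \<longleftrightarrow> m \<le> d i" "(w - x) i \<le> -1 \<longleftrightarrow> d i \<le> -1"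
          using p unfolding w m by (auto split: if_splits)
        then show "layer p (w - x) 1 i = layer m d 1 i" unfolding layer_def by simp
      qed
      ultimately show ?thesis by (simp add: d_def)
    qed
  qed
qed

text \<open>
  Induction on the number of layers. Once a single layer \<open>k\<close> is known to lead from \<open>x\<close> into the set, every
  set of layers containing \<open>k\<close> is reached by continuing from there with one layer less. Sets
  avoiding \<open>k\<close> are reached inside the shorter family \<open>insert k I\<close>, or, if that is the whole family,
  by starting with a different layer. A single remaining layer next to \<open>k\<close> is a rounded midpoint.
\<close>

theorem dmc_set_walk:
  assumes S: "S \<subseteq> Zn n" "dmc_set n S"
  assumes "layered n K e" "x \<in> S" "walk x e K \<in> S" "J \<subseteq> K"
  shows "walk x e J \<in> S"
  using assms(3-)
proof (induction "card K" arbitrary: K e x J rule: less_induct)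
  case less
  have fin: "finite K" using less.prems(1) by (simp add: layered_def)
  define m where "m = int (card K)"
  have norm: "linf n (walk x e K - x) = m"
    using linf_walk[OF less.prems(1)] by (simp add: m_def)
  show ?case
  proof (cases "J = {} \<or> J = K")
    case True
    then show ?thesis using less.prems by auto
  next
    case proper: False
    then have "card J < card K" "J \<noteq> {}" using fin less.prems(4) by (auto intro: psubset_card_mono)
    then have "0 < card J" using fin less.prems(4) by (simp add: card_gt_0_iff finite_subset)
    then have m2: "2 \<le> card K" "K \<noteq> {}" using \<open>card J < card K\<close> by auto
    have short: "shift x (layer p (y - x) 1) \<in> S \<and> shift x (layer p (y - x) p) \<in> S"
      if "x \<in> S" "y \<in> S" "linf n (y - x) = p" "0 < p" "p < m" for x y p
    proof -
      have Z: "x \<in> Zn n" "y \<in> Zn n" using that S by auto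
      have "card {1..p} < card K" using that by (simp add: m_def)
      moreover have "layered n {1..p} (layer p (y - x))"
        using layered_layer[OF diff_in_Zn[OF Z] that(3)] .
      moreover have "walk x (layer p (y - x)) {1..p} = y" using walk_layer[OF Z that(3)] .
      ultimately have "walk x (layer p (y - x)) {k} \<in> S" if "1 \<le> k" "k \<le> p" for k
        using less.hyps[of "{1..p}" "layer p (y - x)" x "{k}"] \<open>x \<in> S\<close> \<open>y \<in> S\<close> that by auto
      from this[of 1] this[of p] show ?thesis using that(4) by (simp add: walk_single)
    qed
    have "shift x (layer m (walk x e K - x) 1) \<in> S \<or> shift x (layer m (walk x e K - x) m) \<in> S"
    proof (rule dmc_set_first_or_last[OF S less.prems(2,3) norm])
      show "2 \<le> m" using m2(1) by (simp add: m_def)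
    qed (rule short)
    then have "walk x e {Min K} \<in> S \<or> walk x e {Max K} \<in> S"
      using layered_first[OF less.prems(1) m2(2) norm] layered_last[OF less.prems(1) m2(2) norm]
      by (simp add: walk_single)
    then obtain k where k: "k \<in> K" "walk x e {k} \<in> S"
      using Min_in Max_in fin m2(2) by blast
    have resume: "walk x e I \<in> S" if "walk x e {j} \<in> S" "j \<in> I" "I \<subseteq> K" for j I
    proof -
      have "card (K - {j}) < card K" using that fin by (intro psubset_card_mono) auto
      moreover have "layered n (K - {j}) e" using less.prems(1) by (rule layered_subset) auto
      moreover have "walk (walk x e {j}) e (K - {j}) = walk x e K"
        using that fin by (subst walk_union) (auto simp: insert_absorb)
      ultimately have "walk (walk x e {j}) e (I - {j}) \<in> S"
        using less.hyps[of "K - {j}" e "walk x e {j}" "I - {j}"] that less.prems(3) by auto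
      moreover have "walk (walk x e {j}) e (I - {j}) = walk x e I"
        using that fin finite_subset[OF that(3)] by (subst walk_union) (auto simp: insert_absorb)
      ultimately show ?thesis by simp
    qed
    have avoid: "walk x e I \<in> S" if "insert k I \<noteq> K" "I \<subseteq> K" for I
    proof -
      have "card (insert k I) < card K" using that fin k by (intro psubset_card_mono) auto
      moreover have "walk x e (insert k I) \<in> S" using resume[OF k(2)] that k by auto
      moreover have "layered n (insert k I) e" using less.prems(1) that k by (auto intro: layered_subset)
      ultimately show ?thesis using less.hyps[of "insert k I" e x I] less.prems(2) by auto
    qed
    show ?thesis
    proof (cases "k \<in> J")
      case True
      then show ?thesis using resume[OF k(2)] less.prems(4) by blast
    next
      case False
      show ?thesis
      proof (cases "insert k J = K")
        case False
        then show ?thesis using avoid less.prems(4) by blast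
      next
        case full: True
        then have cJ: "card K = Suc (card J)" using False fin by (metis card_insert_disjoint finite_insert)
        show ?thesis
        proof (cases "card J = 1")
          case True
          then obtain l where l: "J = {l}" by (auto simp: card_1_singleton_iff)
          then have "K = {k, l}" "k \<noteq> l" using full \<open>k \<notin> J\<close> by auto
          have "2 \<le> linf n (x - walk x e K)"
            using norm m2 by (simp add: m_def linf_commute[of n x])
          then have mid: "mid_up x (walk x e K) \<in> S" "mid_down x (walk x e K) \<in> S"
            using S(2) less.prems(2,3) unfolding dmc_set_def by blast+
          show ?thesis
          proof (cases "k < l")
            case True
            then show ?thesis
              using mid(1) mid_walk_pair(1)[of n k l e x] less.prems(1) \<open>K = {k, l}\<close> l by simp
          next
            case False
            then show ?thesis
              using mid(2) mid_walk_pair(2)[of n l k e x] less.prems(1) \<open>K = {k, l}\<close> \<open>k \<noteq> l\<close> l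
              by (simp add: insert_commute)
          qed
        next
          case False
          obtain j where "j \<in> J" using proper by auto
          have "insert k {j} \<noteq> K"
          proof
            assume "insert k {j} = K"
            then have "card K \<le> 2" by (auto simp: card_insert_if)
            then show False using cJ False \<open>0 < card J\<close> by simp
          qed
          moreover have "{j} \<subseteq> K" using \<open>j \<in> J\<close> less.prems(4) by auto
          ultimately have "walk x e {j} \<in> S" by (rule avoid)
          then show ?thesis using \<open>j \<in> J\<close> less.prems(4) by (rule resume)
        qed
      qed
    qed
  qed
qed

section \<open>Exchanging layers\<close>

text \<open>
  The local inequality says that the increment of \<open>\<phi>\<close> from adding one element grows with the set it is
  added to. Adding the elements of \<open>B\<close>, and then those of \<open>A\<close>, one at a time accumulates these
  comparisons.
\<close>

lemma supermodular_of_local: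
  fixes \<phi> :: "'a set \<Rightarrow> real"
  assumes local: "\<And>J k l. insert k (insert l J) \<subseteq> K \<Longrightarrow> k \<notin> J \<Longrightarrow> l \<notin> J \<Longrightarrow> k \<noteq> l \<Longrightarrow>
      \<phi> (insert k J) + \<phi> (insert l J) \<le> \<phi> J + \<phi> (insert k (insert l J))"
    and "finite A" "finite B" "A \<union> B \<subseteq> K" "A \<inter> B = {}"
  shows "\<phi> A + \<phi> B \<le> \<phi> {} + \<phi> (A \<union> B)"
proof -
  have single: "\<phi> (insert a C) + \<phi> (C \<union> D) \<le> \<phi> C + \<phi> (insert a (C \<union> D))"
    if "finite D" "insert a (C \<union> D) \<subseteq> K" "a \<notin> C \<union> D" "C \<inter> D = {}" for a C D
    using that
  proof (induction D rule: finite_induct)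
    case (insert b D)
    have "\<phi> (insert a C) + \<phi> (C \<union> D) \<le> \<phi> C + \<phi> (insert a (C \<union> D))"
      using insert by (intro insert.IH) auto
    moreover have "\<phi> (insert a (C \<union> D)) + \<phi> (insert b (C \<union> D))
        \<le> \<phi> (C \<union> D) + \<phi> (insert a (insert b (C \<union> D)))"
      using insert by (intro local) auto
    ultimately show ?case by simp
  qed simp
  from assms(2,4,5) show ?thesis
  proof (induction A rule: finite_induct)
    case (insert a A)
    have "\<phi> A + \<phi> B \<le> \<phi> {} + \<phi> (A \<union> B)" using insert by (intro insert.IH) auto
    moreover have "\<phi> (insert a A) + \<phi> (A \<union> B) \<le> \<phi> A + \<phi> (insert a (A \<union> B))"
      using insert assms(3) by (intro single) auto
    ultimately show ?case by simp
  qed simp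
qed

lemma effdom_Zn: "effdom n f \<subseteq> Zn n"
  by (auto simp: effdom_def)

lemma locally_dmc_walk:
  assumes f: "locally_dmc n f"
    and K: "layered n K e" "x \<in> effdom n f" "walk x e K \<in> effdom n f" "J \<subseteq> K"
  shows "f (walk x e J) + f (walk x e (K - J)) \<le> f x + f (walk x e K)"
proof -
  have fin: "finite K" using K(1) by (simp add: layered_def)
  have dom: "walk x e I \<in> effdom n f" if "I \<subseteq> K" for I
    using dmc_set_walk[OF effdom_Zn _ K(1-3) that] f by (simp add: locally_dmc_def)
  define \<phi> where "\<phi> I = real_of_ereal (f (walk x e I))" for I
  have \<phi>: "f (walk x e I) = ereal (\<phi> I)" if "I \<subseteq> K" for I
  proof -
    have "f (walk x e I) \<noteq> -\<infinity>" "f (walk x e I) < \<infinity>"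
      using dom[OF that] f by (auto simp: locally_dmc_def no_neg_infinity_def effdom_def)
    then show ?thesis by (cases "f (walk x e I)") (auto simp: \<phi>_def)
  qed
  have "\<phi> J + \<phi> (K - J) \<le> \<phi> {} + \<phi> (J \<union> (K - J))"
  proof (rule supermodular_of_local[where K = K])
    have ordered: "\<phi> (insert k I) + \<phi> (insert l I) \<le> \<phi> I + \<phi> (insert k (insert l I))"
      if kl: "insert k (insert l I) \<subseteq> K" "k \<notin> I" "l \<notin> I" "k < l" for I k l
    proof -
      have I: "finite I" using kl(1) fin finite_subset by (metis insert_subset)
      have lay: "layered n {k, l} e" using K(1) kl(1) by (auto intro: layered_subset)
      have eq: "walk (walk x e I) e {k} = walk x e (insert k I)"
        "walk (walk x e I) e {l} = walk x e (insert l I)"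
        "walk (walk x e I) e {k, l} = walk x e (insert k (insert l I))"
        using I kl by (subst walk_union; auto)+
      have "walk x e I \<in> Zn n" "walk x e (insert k (insert l I)) \<in> Zn n"
        using dom[of I] dom[OF kl(1)] kl(1) effdom_Zn by blast+
      moreover have "linf n (walk x e I - walk x e (insert k (insert l I))) = 2"
        using linf_walk[OF lay, of "walk x e I"] kl(4) by (simp add: eq linf_commute[of n "walk x e I"])
      ultimately have "dmc_ineq f (walk x e I) (walk x e (insert k (insert l I)))"
        using f unfolding locally_dmc_def by blast
      then have "f (walk x e (insert l I)) + f (walk x e (insert k I))
          \<le> f (walk x e I) + f (walk x e (insert k (insert l I)))"
        using mid_walk_pair[OF lay kl(4), of "walk x e I"] by (simp add: dmc_ineq_def eq)
      then show ?thesis using kl(1) by (simp add: \<phi>)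
    qed
    show "\<phi> (insert k I) + \<phi> (insert l I) \<le> \<phi> I + \<phi> (insert k (insert l I))"
      if "insert k (insert l I) \<subseteq> K" "k \<notin> I" "l \<notin> I" "k \<noteq> l" for k l I
      using ordered[of k l I] ordered[of l k I] that by (cases "k < l") (auto simp: insert_commute)
  qed (use K(4) fin in \<open>auto intro: finite_subset\<close>)
  moreover have "J \<union> (K - J) = K" using K(4) by blast
  ultimately show ?thesis using K(4) \<phi>[of "{}"] by (simp add: \<phi>)
qed

text \<open>
  The parallelogram inequality: \<open>x\<close> and \<open>y\<close> approach each other along an arbitrary choice of layers.
\<close>

theorem locally_dmc_exchange:
  fixes x y :: point and J :: "int set"
  assumes f: "locally_dmc n f" "x \<in> effdom n f" "y \<in> effdom n f"
    and m: "linf n (y - x) = m" "J \<subseteq> {1..m}"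
  defines "c \<equiv> \<lambda>i. \<Sum>k\<in>J. layer m (y - x) k i"
  shows "f (shift x c) + f (y - c) \<le> f x + f y" "shift x c \<in> effdom n f" "y - c \<in> effdom n f"
proof -
  have Z: "x \<in> Zn n" "y \<in> Zn n" using f(2,3) by (auto simp: effdom_def)
  note lay = layered_layer[OF diff_in_Zn[OF Z] m(1)]
  note full = walk_layer[OF Z m(1)]
  have c: "walk x (layer m (y - x)) J = shift x c"
    by (simp add: walk_def shift_def c_def)
  have c': "walk x (layer m (y - x)) ({1..m} - J) = y - c"
  proof
    fix i
    have "y i = x i + (\<Sum>k\<in>{1..m}. layer m (y - x) k i)" using full by (metis walk_def)
    also have "(\<Sum>k\<in>{1..m}. layer m (y - x) k i) = (\<Sum>k\<in>{1..m} - J. layer m (y - x) k i) + c i"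
      using m(2) by (simp add: c_def sum.subset_diff)
    finally show "walk x (layer m (y - x)) ({1..m} - J) i = (y - c) i" by (simp add: walk_def)
  qed
  show "f (shift x c) + f (y - c) \<le> f x + f y"
    using locally_dmc_walk[OF f(1) lay f(2) _ m(2)] f(3) by (simp add: full c c')
  have "walk x (layer m (y - x)) I \<in> effdom n f" if "I \<subseteq> {1..m}" for I
    using dmc_set_walk[OF effdom_Zn _ lay f(2) _ that] f by (simp add: full locally_dmc_def)
  then show "shift x c \<in> effdom n f" "y - c \<in> effdom n f"
    using m(2) by (metis c, metis c' Diff_subset)
qed

lemma effdom_finite_value:
  assumes "locally_dmc n f" "x \<in> effdom n f"
  obtains r where "f x = ereal r"
  using assms by (cases "f x") (auto simp: locally_dmc_def no_neg_infinity_def effdom_def)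

lemma cube_iff: "0 \<le> k \<Longrightarrow> y \<in> cube n x k \<longleftrightarrow> y \<in> Zn n \<and> (\<forall>i<n. \<bar>y i - x i\<bar> \<le> k)"
  by (simp add: cube_def linf_le_iff)

text \<open>
  Along the first and the last layer together, every coordinate of \<open>z\<close> that differs from \<open>y\<close> moves
  towards \<open>y\<close>. A coordinate on the boundary of the larger ball does differ, so \<open>z\<close> enters the smaller ball,
  where values are at least \<open>f y\<close>; the exchange inequality then bounds the other new point by \<open>f z\<close>.
  A single layer would not do: the first one leaves positive differences below the maximum in place.
\<close>

lemma ball_cube_step:
  assumes f: "locally_dmc n f" and k: "1 \<le> k"
    and y: "y \<in> effdom n f" "y \<in> cube n c (k - 1)" "\<And>w. w \<in> cube n c (k - 1) \<Longrightarrow> f y \<le> f w"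
    and z: "z \<in> cube n c k"
  obtains w where "w \<in> cube n y 2" "w \<in> cube n c k" "f w \<le> f z"
proof -
  define m where "m = linf n (z - y)"
  have yc: "\<bar>y i - c i\<bar> \<le> k - 1" if "i < n" for i using y(2) k that by (simp add: cube_iff)
  have zc: "\<bar>z i - c i\<bar> \<le> k" if "i < n" for i using z k that by (simp add: cube_iff)
  have yZ: "y \<in> Zn n" and zZ: "z \<in> Zn n" using y z by (auto simp: cube_def)
  consider "f z = \<infinity>" | "m \<le> 2" | "f z < \<infinity>" "3 \<le> m" by fastforce
  then show ?thesis
  proof cases
    case 1
    have "y \<in> cube n c k" using y(2) k by (auto simp: cube_def)
    moreover have "y \<in> cube n y 2" using yZ by (simp add: cube_iff)
    ultimately show ?thesis using that 1 by simp
  next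
    case 2
    then show ?thesis using that[of z] z by (simp add: cube_def m_def)
  next
    case 3
    then have z_dom: "z \<in> effdom n f" using zZ by (simp add: effdom_def)
    define s where "s = (\<lambda>i. \<Sum>k\<in>{1, m}. layer m (z - y) k i)"
    have s: "s i = layer m (z - y) 1 i + layer m (z - y) m i" for i using 3 by (simp add: s_def)
    have toward: "(0 < z i - y i \<longrightarrow> 1 \<le> s i \<and> s i \<le> 2 \<and> s i \<le> z i - y i) \<and>
        (z i - y i < 0 \<longrightarrow> s i \<le> -1 \<and> -2 \<le> s i \<and> z i - y i \<le> s i) \<and> (z i = y i \<longrightarrow> s i = 0)" for i
      using 3(2) by (auto simp: s layer_def)
    note ex = locally_dmc_exchange[OF f y(1) z_dom m_def[symmetric], of "{1, m}", folded s_def]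
    have J: "{1, m} \<subseteq> {1..m}" using 3 by auto
    note ex = ex[OF J]
    have Z: "shift y s \<in> Zn n" "z - s \<in> Zn n" using ex(2,3) effdom_Zn by blast+
    have "\<bar>(z - s) i - c i\<bar> \<le> k - 1" if "i < n" for i
      using toward[of i] yc[OF that] zc[OF that] by simp linarith
    then have "z - s \<in> cube n c (k - 1)" using Z k by (simp add: cube_iff)
    then have "f y \<le> f (z - s)" by (rule y(3))
    moreover obtain a b d e where "f y = ereal a" "f z = ereal b" "f (z - s) = ereal d" "f (shift y s) = ereal e"
      using effdom_finite_value[OF f] y(1) z_dom ex(2,3) by metis
    ultimately have "f (shift y s) \<le> f z" using ex(1) by simp
    moreover have "\<bar>shift y s i - c i\<bar> \<le> k" if "i < n" for i
      using toward[of i] yc[OF that] zc[OF that] unfolding shift_def by linarith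
    then have "shift y s \<in> cube n c k" using Z k by (simp add: cube_iff)
    moreover have "\<bar>shift y s i - y i\<bar> \<le> 2" for i
      using toward[of i] unfolding shift_def by linarith
    then have "shift y s \<in> cube n y 2" using Z by (simp add: cube_iff)
    ultimately show ?thesis using that by blast
  qed
qed

text \<open>
  Removing the first layer shortens the distance to \<open>y\<close> by 1 and adds to \<open>y\<close> a vector with entries in
  \<open>{-1, 0, 1}\<close>, which by assumption does not decrease the value there.
\<close>

lemma local_minimum_is_global:
  assumes f: "locally_dmc n f" and y: "y \<in> effdom n f" "\<And>w. w \<in> cube n y 1 \<Longrightarrow> f y \<le> f w"
    and "z \<in> Zn n"
  shows "f y \<le> f z"
  using assms(4)
proof (induction "nat (linf n (z - y))" arbitrary: z rule: less_induct)
  case less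
  define m where "m = linf n (z - y)"
  have yZ: "y \<in> Zn n" using y(1) effdom_Zn by blast
  consider "f z = \<infinity>" | "m \<le> 1" | "f z < \<infinity>" "2 \<le> m" by fastforce
  then show ?case
  proof cases
    case 2
    then show ?thesis using y(2)[of z] less.prems by (simp add: cube_def m_def)
  next
    case 3
    then have z_dom: "z \<in> effdom n f" using less.prems by (simp add: effdom_def)
    define s where "s = (\<lambda>i. \<Sum>k\<in>{1}. layer m (z - y) k i)"
    have s: "s i = layer m (z - y) 1 i" for i by (simp add: s_def)
    note ex = locally_dmc_exchange[OF f y(1) z_dom m_def[symmetric], of "{1}", folded s_def]
    have J: "{1} \<subseteq> {1..m}" using 3 by auto
    note ex = ex[OF J]
    have Z: "shift y s \<in> Zn n" "z - s \<in> Zn n" using ex(2,3) effdom_Zn by blast+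
    have "\<bar>shift y s i - y i\<bar> \<le> 1" for i by (simp add: shift_def s layer_def)
    then have "f y \<le> f (shift y s)" using y(2) Z(1) by (simp add: cube_iff)
    moreover have "\<bar>(z - s - y) i\<bar> \<le> m - 1" if "i < n" for i
      using abs_le_linf[OF that, of "z - y"] 3(2) by (auto simp: m_def s layer_def)
    then have "linf n (z - s - y) \<le> m - 1" using 3(2) linf_le_iff[of "m - 1" n] by simp
    then have "f y \<le> f (z - s)" using less.hyps[of "z - s"] Z(2) 3(2) by (simp add: m_def)
    moreover obtain a b d e where "f y = ereal a" "f z = ereal b" "f (z - s) = ereal d" "f (shift y s) = ereal e"
      using effdom_finite_value[OF f] y(1) z_dom ex(2,3) by metis
    ultimately show ?thesis using ex(1) by simp
  qed simp
qed

section \<open>Proximity\<close>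

text \<open>
  Pigeonhole: coordinate \<open>i\<close> tells apart two neighbouring layers for one index at most, namely
  \<open>m - d i\<close> if \<open>d i\<close> is positive and \<open>- d i\<close> if it is negative. A coordinate attaining the norm tells none apart, which leaves at most \<open>n - 1\<close>
  changes between \<open>m > n\<close> layers.
\<close>

lemma repeated_layer:
  assumes d: "linf n d = m" and large: "int n < m"
  obtains k where "1 \<le> k" "k < m" "\<And>i. i < n \<Longrightarrow> layer m d k i = layer m d (k + 1) i"
proof (rule ccontr)
  note found = that
  assume none: "\<not> thesis"
  obtain j where j: "j < n" "\<bar>d j\<bar> = m" using linf_attained[of n d] large d by auto
  define c where "c i = (if 0 < d i then m - d i else - d i)" for i
  have "{1..m - 1} \<subseteq> c ` ({..<n} - {j})"
  proof
    fix k assume "k \<in> {1..m - 1}"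
    then have k: "1 \<le> k" "k < m" by auto
    then obtain i where i: "i < n" "layer m d k i \<noteq> layer m d (k + 1) i"
      using found[of k] none by auto
    have "i \<noteq> j" using i j(2) k by (auto simp: layer_def abs_if split: if_splits)
    moreover have "k = c i" using i(2) k by (auto simp: layer_def c_def split: if_splits)
    ultimately show "k \<in> c ` ({..<n} - {j})" using i(1) by auto
  qed
  then have "card {1..m - 1} \<le> card ({..<n} - {j})" by (intro surj_card_le) auto
  then show False using j(1) large by simp
qed

text \<open>
  Take a minimizer \<open>z\<close> of least 1-norm. If it were outside the box, two equal neighbouring layers of \<open>z\<close>
  could be moved over to 0. No even vector has a smaller value than 0, so \<open>z\<close> without the two layers
  would again be a minimizer, of smaller 1-norm.
\<close>

theorem scaling_proximity:
  assumes f: "locally_dmc n f" and fin: "finite (effdom n f)" and zero: "(\<lambda>_. 0) \<in> effdom n f"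
    and even: "\<And>y. y \<in> Zn n \<Longrightarrow> f (\<lambda>_. 0) \<le> f (\<lambda>i. 2 * y i)"
  obtains z where "z \<in> effdom n f" "linf n z \<le> int n" "\<And>w. w \<in> Zn n \<Longrightarrow> f z \<le> f w"
proof -
  define Opt where "Opt z \<longleftrightarrow> z \<in> effdom n f \<and> (\<forall>w\<in>Zn n. f z \<le> f w)" for z
  define size where "size z = (\<Sum>i<n. nat \<bar>z i\<bar>)" for z :: point
  obtain z0 where "is_arg_min f (\<lambda>z. z \<in> effdom n f) z0"
    using ex_is_arg_min_if_finite[OF fin, of f] zero by blast
  then have z0: "z0 \<in> effdom n f" "\<And>w. w \<in> effdom n f \<Longrightarrow> f z0 \<le> f w"
    by (auto simp: is_arg_min_linorder)
  have "f z0 \<le> f w" if "w \<in> Zn n" for w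
    using z0(2)[of w] that by (cases "f w = \<infinity>") (auto simp: effdom_def)
  then have "Opt z0" using z0(1) by (simp add: Opt_def)
  then obtain z where z: "Opt z" and least: "\<And>w. Opt w \<Longrightarrow> size z \<le> size w"
    using ex_has_least_nat[of Opt z0 size] by blast
  define m where "m = linf n z"
  have "m \<le> int n"
  proof (rule ccontr)
    assume "\<not> m \<le> int n"
    then have large: "int n < m" by simp
    then obtain k where k: "1 \<le> k" "k < m" "\<And>i. i < n \<Longrightarrow> layer m z k i = layer m z (k + 1) i"
      using repeated_layer[of n z m] m_def by blast
    have z_dom: "z \<in> effdom n f" using z by (simp add: Opt_def)
    have z': "z - (\<lambda>_. 0) = z" by (simp add: fun_eq_iff)
    define s where "s = (\<lambda>i. \<Sum>k\<in>{k, k + 1}. layer m z k i)"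
    have J: "{k, k + 1} \<subseteq> {1..m}" using k by auto
    have norm: "linf n (z - (\<lambda>_. 0)) = m" by (simp add: z' m_def)
    note ex = locally_dmc_exchange[OF f zero z_dom norm J, unfolded z', folded s_def]
    have layZ: "layer m z k \<in> Zn n"
      using layered_layer[of z n m] z_dom k by (auto simp: m_def layered_def effdom_def)
    have s: "s i = 2 * layer m z k i" for i
    proof (cases "i < n")
      case True
      then show ?thesis using k by (simp add: s_def)
    next
      case False
      have "layer m z l i = 0" if "l \<in> {1..m}" for l
        using layered_layer[of z n m] z_dom that False by (auto simp: m_def layered_def effdom_def Zn_def)
      then show ?thesis using k by (simp add: s_def)
    qed
    have "shift (\<lambda>_. 0) s = (\<lambda>i. 2 * layer m z k i)" by (simp add: shift_def s)
    then have "f (\<lambda>_. 0) \<le> f (shift (\<lambda>_. 0) s)" using even[OF layZ] by simp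
    moreover obtain a b d e where "f (\<lambda>_. 0) = ereal a" "f z = ereal b" "f (z - s) = ereal d"
        "f (shift (\<lambda>_. 0) s) = ereal e"
      using effdom_finite_value[OF f] zero z_dom ex(2,3) by metis
    ultimately have "f (z - s) \<le> f z" using ex(1) by simp
    then have "Opt (z - s)" using z ex(3) unfolding Opt_def by (metis order_trans)
    then have "size z \<le> size (z - s)" by (rule least)
    have smaller: "\<bar>z i - s i\<bar> < \<bar>z i\<bar> \<or> layer m z k i = 0" if "i < n" for i
      using k(3)[OF that] k(1,2) unfolding s by (auto simp: layer_def split: if_splits)
    obtain j where j: "j < n" "\<bar>z j\<bar> = m" using linf_attained[of n z] large m_def by auto
    have "size (z - s) < size z"
      unfolding size_def
    proof (rule sum_strict_mono_ex1)
      show "\<forall>i\<in>{..<n}. nat \<bar>(z - s) i\<bar> \<le> nat \<bar>z i\<bar>"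
        using smaller s by fastforce
      have "layer m z k j \<noteq> 0" using j k(1,2) by (auto simp: layer_def abs_if split: if_splits)
      then show "\<exists>i\<in>{..<n}. nat \<bar>(z - s) i\<bar> < nat \<bar>z i\<bar>"
        using smaller[OF j(1)] j(1) by (intro bexI[of _ j]) auto
    qed simp
    with \<open>size z \<le> size (z - s)\<close> show False by simp
  qed
  then show ?thesis using that z unfolding Opt_def m_def by blast
qed

section \<open>Scaling and restriction\<close>

text \<open>
  Only the convexity of the effective domain needs an argument: both summands on the smaller side of
  the inequality are finite if the larger side is, as neither can be \<open>-\<infinity>\<close>.
\<close>

lemma globally_imp_locally_dmc:
  assumes "globally_dmc n f"
  shows "locally_dmc n f"
proof -
  have "mid_up x y \<in> effdom n f \<and> mid_down x y \<in> effdom n f"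
    if xy: "x \<in> effdom n f" "y \<in> effdom n f" "2 \<le> linf n (x - y)" for x y
  proof -
    have Z: "x \<in> Zn n" "y \<in> Zn n" using xy by (auto simp: effdom_def)
    then have mid: "mid_up x y \<in> Zn n" "mid_down x y \<in> Zn n" using mid_in_Zn by blast+
    have "dmc_ineq f x y" using assms xy(3) Z by (simp add: globally_dmc_def)
    moreover have "f (mid_up x y) \<noteq> -\<infinity>" "f (mid_down x y) \<noteq> -\<infinity>"
      using assms mid by (auto simp: globally_dmc_def no_neg_infinity_def)
    moreover have "f x < \<infinity>" "f y < \<infinity>" using xy by (auto simp: effdom_def)
    ultimately show ?thesis using mid unfolding dmc_ineq_def effdom_def
      by (cases "f (mid_up x y)"; cases "f (mid_down x y)"; cases "f x"; cases "f y") auto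
  qed
  then show ?thesis using assms unfolding globally_dmc_def locally_dmc_def dmc_set_def by auto
qed

lemma shift_in_Zn: "x \<in> Zn n \<Longrightarrow> y \<in> Zn n \<Longrightarrow> shift x y \<in> Zn n"
  by (simp add: Zn_def shift_def)

lemma locally_dmc_shift:
  assumes "locally_dmc n f" "x \<in> Zn n"
  shows "locally_dmc n (\<lambda>y. f (shift x y))"
proof -
  have "mid_up (shift x y) (shift x z) i = shift x (mid_up y z) i" for y z i
    using div_mult_self4[of 2 "y i + z i + 1" "x i"] by (simp add: mid_up_div shift_def algebra_simps)
  moreover have "mid_down (shift x y) (shift x z) i = shift x (mid_down y z) i" for y z i
    using div_mult_self4[of 2 "y i + z i" "x i"] by (simp add: mid_down_div shift_def algebra_simps)
  ultimately have mid: "mid_up (shift x y) (shift x z) = shift x (mid_up y z)"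
      "mid_down (shift x y) (shift x z) = shift x (mid_down y z)" for y z
    by blast+
  have diff: "shift x y - shift x z = y - z" for y z by (simp add: fun_eq_iff shift_def)
  have dom: "y \<in> effdom n (\<lambda>y. f (shift x y)) \<longleftrightarrow> y \<in> Zn n \<and> shift x y \<in> effdom n f" for y
    using shift_in_Zn[OF assms(2)] by (auto simp: effdom_def)
  show ?thesis
    unfolding locally_dmc_def
  proof (intro conjI ballI impI)
    show "no_neg_infinity n (\<lambda>y. f (shift x y))"
      using assms shift_in_Zn by (auto simp: locally_dmc_def no_neg_infinity_def)
    show "dmc_set n (effdom n (\<lambda>y. f (shift x y)))"
      unfolding dmc_set_def dom
    proof (intro ballI impI)
      fix y z
      assume yz: "y \<in> effdom n (\<lambda>y. f (shift x y))" "z \<in> effdom n (\<lambda>y. f (shift x y))" "2 \<le> linf n (y - z)"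
      then have "shift x (mid_up y z) \<in> effdom n f \<and> shift x (mid_down y z) \<in> effdom n f"
        using assms(1) unfolding dom locally_dmc_def dmc_set_def by (metis diff mid)
      then show "(mid_up y z \<in> Zn n \<and> shift x (mid_up y z) \<in> effdom n f) \<and>
          mid_down y z \<in> Zn n \<and> shift x (mid_down y z) \<in> effdom n f"
        using mid_in_Zn yz unfolding dom by blast
    qed
    show "dmc_ineq (\<lambda>y. f (shift x y)) y z" if "y \<in> Zn n" "z \<in> Zn n" "linf n (y - z) = 2" for y z
    proof -
      have "dmc_ineq f (shift x y) (shift x z)"
        using assms that shift_in_Zn unfolding locally_dmc_def by (metis diff)
      then show ?thesis by (simp add: dmc_ineq_def mid)
    qed
  qed
qed

definition double :: "point \<Rightarrow> point" where
  "double y = (\<lambda>i. 2 * y i)"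

text \<open>
  The midpoint of \<open>2 y\<close> and \<open>2 z\<close> is \<open>y + z\<close>. Averaging each end point with it, and then the
  resulting points with each other, leads to twice the rounded midpoints of \<open>y\<close> and \<open>z\<close>.
\<close>

lemma double_mids:
  fixes y z :: point
  defines "u \<equiv> mid_up y z" and "d \<equiv> mid_down y z"
  shows "mid_up (double y) (shift y z) = shift y u" "mid_down (double y) (shift y z) = shift y d"
    "mid_up (double z) (shift y z) = shift z u" "mid_down (double z) (shift y z) = shift z d"
    "mid_up (shift y u) (shift z u) = double u" "mid_down (shift y u) (shift z u) = shift y z"
    "mid_up (shift y d) (shift z d) = shift y z" "mid_down (shift y d) (shift z d) = double d"
  unfolding u_def d_def
  by (rule ext; simp add: mid_up_div mid_down_div shift_def double_def; presburger)+

lemma double_in_Zn: "y \<in> Zn n \<Longrightarrow> double y \<in> Zn n"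
  by (simp add: Zn_def double_def)

lemma double_diffs: "double y - shift y z = y - z" "double z - shift y z = z - y"
    "shift y w - shift z w = y - z"
  by (simp_all add: fun_eq_iff double_def shift_def)

lemma linf_double: "linf n (double y - double z) = 2 * linf n (y - z)"
proof (cases "linf n (y - z) = 0")
  case True
  then have "\<bar>(y - z) i\<bar> \<le> 0" if "i < n" for i using abs_le_linf[OF that, of "y - z"] by simp
  then have "linf n (double y - double z) \<le> 0" by (simp add: linf_le_iff double_def)
  then show ?thesis using True linf_nonneg[of n "double y - double z"] by simp
next
  case False
  then have "0 < linf n (y - z)" using linf_nonneg[of n "y - z"] by simp
  then obtain j where j: "j < n" "\<bar>(y - z) j\<bar> = linf n (y - z)" by (rule linf_attained)
  show ?thesis
  proof (rule linf_eqI[OF _ j(1)])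
    show "\<bar>(double y - double z) i\<bar> \<le> 2 * linf n (y - z)" if "i < n" for i
      using abs_le_linf[OF that, of "y - z"] by (simp add: double_def)
    show "\<bar>(double y - double z) j\<bar> = 2 * linf n (y - z)"
      using j(2) by (simp add: double_def)
  qed
qed

text \<open>
  All four pairs of points in \<open>double_mids\<close> are as far apart as \<open>y\<close> and \<open>z\<close>, so they are in the scope
  of local midpoint convexity if \<open>y\<close> and \<open>z\<close> have distance 2. In the sum of the four inequalities
  everything but the values at \<open>2 y\<close>, \<open>2 z\<close> and the doubled rounded midpoints of \<open>y\<close> and \<open>z\<close> cancels.
\<close>

lemma locally_dmc_double:
  assumes f: "locally_dmc n f"
  shows "locally_dmc n (\<lambda>y. f (double y))"
proof -
  let ?E = "effdom n f"
  have S: "mid_up x y \<in> ?E" "mid_down x y \<in> ?E" if "x \<in> ?E" "y \<in> ?E" "2 \<le> linf n (x - y)" for x y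
    using f that unfolding locally_dmc_def dmc_set_def by blast+
  have dom: "y \<in> effdom n (\<lambda>y. f (double y)) \<longleftrightarrow> y \<in> Zn n \<and> double y \<in> ?E" for y
    using double_in_Zn by (auto simp: effdom_def)
  have points: "shift y z \<in> ?E"
      "shift y (mid_up y z) \<in> ?E" "shift y (mid_down y z) \<in> ?E"
      "shift z (mid_up y z) \<in> ?E" "shift z (mid_down y z) \<in> ?E"
      "double (mid_up y z) \<in> ?E" "double (mid_down y z) \<in> ?E"
    if yz: "double y \<in> ?E" "double z \<in> ?E" "2 \<le> linf n (y - z)" for y z
  proof -
    have zy: "2 \<le> linf n (z - y)" using yz(3) by (simp add: linf_commute)
    have "mid_up (double y) (double z) = shift y z"
      by (simp add: fun_eq_iff mid_up_div double_def shift_def; presburger)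
    moreover have "2 \<le> linf n (double y - double z)" using yz(3) by (simp add: linf_double)
    ultimately show c: "shift y z \<in> ?E" using S(1)[OF yz(1,2)] by simp
    show yu: "shift y (mid_up y z) \<in> ?E" and yd: "shift y (mid_down y z) \<in> ?E"
      using S[OF yz(1) c] yz(3) by (simp_all add: double_diffs double_mids)
    show zu: "shift z (mid_up y z) \<in> ?E" and zd: "shift z (mid_down y z) \<in> ?E"
      using S[OF yz(2) c] zy by (simp_all add: double_diffs double_mids)
    show "double (mid_up y z) \<in> ?E" using S(1)[OF yu zu] yz(3) by (simp add: double_diffs double_mids)
    show "double (mid_down y z) \<in> ?E" using S(2)[OF yd zd] yz(3) by (simp add: double_diffs double_mids)
  qed
  show ?thesis
    unfolding locally_dmc_def
  proof (intro conjI ballI impI)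
    show "no_neg_infinity n (\<lambda>y. f (double y))"
      using f double_in_Zn by (auto simp: locally_dmc_def no_neg_infinity_def)
    show "dmc_set n (effdom n (\<lambda>y. f (double y)))"
      unfolding dmc_set_def
    proof (intro ballI impI)
      fix y z
      assume "y \<in> effdom n (\<lambda>y. f (double y))" "z \<in> effdom n (\<lambda>y. f (double y))" "2 \<le> linf n (y - z)"
      then show "mid_up y z \<in> effdom n (\<lambda>y. f (double y)) \<and> mid_down y z \<in> effdom n (\<lambda>y. f (double y))"
        using points(6,7)[of y z] mid_in_Zn[of y n z] by (simp add: dom)
    qed
    fix y z
    assume yz: "y \<in> Zn n" "z \<in> Zn n" "linf n (y - z) = 2"
    have no_neg: "f w \<noteq> -\<infinity>" if "w \<in> Zn n" for w
      using f that by (simp add: locally_dmc_def no_neg_infinity_def)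
    show "dmc_ineq (\<lambda>y. f (double y)) y z"
    proof (cases "double y \<in> ?E \<and> double z \<in> ?E")
      case False
      then have "f (double y) = \<infinity> \<or> f (double z) = \<infinity>" using yz double_in_Zn by (auto simp: effdom_def)
      then show ?thesis using no_neg yz double_in_Zn unfolding dmc_ineq_def by auto
    next
      case True
      then have yz2: "double y \<in> ?E" "double z \<in> ?E" "2 \<le> linf n (y - z)" using yz by auto
      note P = points[OF yz2]
      have ineq: "f (mid_up a b) + f (mid_down a b) \<le> f a + f b"
        if "a \<in> ?E" "b \<in> ?E" "linf n (a - b) = 2" for a b
      proof -
        have "a \<in> Zn n" "b \<in> Zn n" using that effdom_Zn by blast+
        then show ?thesis using f that(3) unfolding locally_dmc_def dmc_ineq_def by blast
      qed
      have zy: "linf n (z - y) = 2" using yz(3) by (simp add: linf_commute)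
      let ?u = "mid_up y z" and ?d = "mid_down y z"
      have I: "f (shift y ?u) + f (shift y ?d) \<le> f (double y) + f (shift y z)"
        "f (shift z ?u) + f (shift z ?d) \<le> f (double z) + f (shift y z)"
        "f (double ?u) + f (shift y z) \<le> f (shift y ?u) + f (shift z ?u)"
        "f (shift y z) + f (double ?d) \<le> f (shift y ?d) + f (shift z ?d)"
        using ineq[OF yz2(1) P(1)] ineq[OF yz2(2) P(1)] ineq[OF P(2,4)] ineq[OF P(3,5)] yz(3) zy
        by (simp_all add: double_diffs double_mids)
      obtain c1 c2 c3 c4 c5 c6 c7 c8 c9 where
        "f (double y) = ereal c1" "f (double z) = ereal c2" "f (shift y z) = ereal c3"
        "f (shift y ?u) = ereal c4" "f (shift y ?d) = ereal c5" "f (shift z ?u) = ereal c6"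
        "f (shift z ?d) = ereal c7" "f (double ?u) = ereal c8" "f (double ?d) = ereal c9"
        using effdom_finite_value[OF f] yz2 P by metis
      then show ?thesis using I unfolding dmc_ineq_def by simp
    qed
  qed
qed

lemma move_in_Zn: "x \<in> Zn n \<Longrightarrow> y \<in> Zn n \<Longrightarrow> move x \<alpha> y \<in> Zn n"
  by (simp add: Zn_def move_def)

lemma locally_dmc_move:
  assumes "locally_dmc n f" "x \<in> Zn n"
  shows "locally_dmc n (\<lambda>y. f (move x (2 ^ t) y))"
proof (induction t)
  case 0
  then show ?case using locally_dmc_shift[OF assms] by (simp add: move_def shift_def)
next
  case (Suc t)
  have "move x (2 ^ t) (double y) = move x (2 ^ Suc t) y" for y
    by (simp add: fun_eq_iff move_def double_def)
  then show ?case using locally_dmc_double[OF Suc] by simp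
qed

lemma locally_dmc_restrict_box:
  assumes f: "locally_dmc n f"
  shows "locally_dmc n (\<lambda>y. if linf n y \<le> int r then f y else \<infinity>)" (is "locally_dmc n ?g")
proof -
  have mid: "linf n (mid_up y z) \<le> int r \<and> linf n (mid_down y z) \<le> int r"
    if "linf n y \<le> int r" "linf n z \<le> int r" for y z
  proof -
    have "\<bar>mid_up y z i\<bar> \<le> int r \<and> \<bar>mid_down y z i\<bar> \<le> int r" if "i < n" for i
    proof -
      have "\<bar>y i\<bar> \<le> int r" "\<bar>z i\<bar> \<le> int r"
        using \<open>linf n y \<le> int r\<close> \<open>linf n z \<le> int r\<close> that by (auto simp: linf_le_iff)
      then show ?thesis unfolding mid_up_div mid_down_div by (auto simp: abs_le_iff)
    qed
    then show ?thesis by (simp add: linf_le_iff)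
  qed
  have dom: "y \<in> effdom n ?g \<longleftrightarrow> y \<in> effdom n f \<and> linf n y \<le> int r" for y
    by (auto simp: effdom_def)
  have no_neg: "?g y \<noteq> -\<infinity>" if "y \<in> Zn n" for y
    using f that by (auto simp: locally_dmc_def no_neg_infinity_def)
  show ?thesis
    unfolding locally_dmc_def
  proof (intro conjI ballI impI)
    show "no_neg_infinity n ?g" using no_neg unfolding no_neg_infinity_def by blast
    have "dmc_set n (effdom n f)" using f by (simp add: locally_dmc_def)
    then have "mid_up y z \<in> effdom n ?g \<and> mid_down y z \<in> effdom n ?g"
      if "y \<in> effdom n ?g" "z \<in> effdom n ?g" "2 \<le> linf n (y - z)" for y z
      using that mid[of y z] unfolding dmc_set_def dom by blast
    then show "dmc_set n (effdom n ?g)" unfolding dmc_set_def by blast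
    fix y z
    assume yz: "y \<in> Zn n" "z \<in> Zn n" "linf n (y - z) = 2"
    then have "dmc_ineq f y z" using f by (simp add: locally_dmc_def)
    show "dmc_ineq ?g y z"
    proof (cases "linf n y \<le> int r \<and> linf n z \<le> int r")
      case True
      then show ?thesis using mid[of y z] \<open>dmc_ineq f y z\<close> by (simp add: dmc_ineq_def)
    next
      case False
      then have "?g y = \<infinity> \<or> ?g z = \<infinity>" by auto
      then have "?g y + ?g z = \<infinity>" using no_neg[OF yz(1)] no_neg[OF yz(2)] by auto
      then show ?thesis unfolding dmc_ineq_def by (metis ereal_less_eq(1))
    qed
  qed
qed

section \<open>The descent algorithm\<close>

lemma integer_interval_cube:
  assumes "0 \<le> k"
  shows "integer_interval n (cube n y k)"
  unfolding integer_interval_def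
proof (intro exI)
  show "cube n y k = {z \<in> Zn n. \<forall>i<n. y i - k \<le> z i \<and> z i \<le> y i + k}"
    using cube_iff[OF assms] by (auto simp: abs_le_iff algebra_simps)
qed

lemma center_in_cube: "y \<in> Zn n \<Longrightarrow> 0 \<le> k \<Longrightarrow> y \<in> cube n y k"
  by (simp add: cube_iff)

lemma oracle_answer:
  assumes "two_nbhd_oracle n m orc" "locally_dmc n g" "y \<in> effdom n g" "y \<in> cube n c k" "0 \<le> k"
  defines "w \<equiv> answer g (orc y (cube n c k))"
  shows "w \<in> effdom n g" "w \<in> cube n y 2" "w \<in> cube n c k" "evals g (orc y (cube n c k)) \<le> m"
    "\<And>v. v \<in> cube n y 2 \<Longrightarrow> v \<in> cube n c k \<Longrightarrow> g w \<le> g v"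
proof -
  have y: "y \<in> cube n y 2 \<inter> cube n c k"
    using assms(3,4) center_in_cube[of y n 2] by (simp add: effdom_def)
  have "is_arg_min g (\<lambda>v. v \<in> cube n y 2 \<inter> cube n c k) w \<and> evals g (orc y (cube n c k)) \<le> m"
    using assms(1-3) integer_interval_cube[OF assms(5)] y unfolding two_nbhd_oracle_def w_def by blast
  then show w: "w \<in> cube n y 2" "w \<in> cube n c k" "evals g (orc y (cube n c k)) \<le> m"
    "\<And>v. v \<in> cube n y 2 \<Longrightarrow> v \<in> cube n c k \<Longrightarrow> g w \<le> g v"
    by (auto simp: is_arg_min_linorder)
  have "g w \<le> g y" using w(4) y by blast
  also have "g y < \<infinity>" using assms(3) by (simp add: effdom_def)
  finally show "w \<in> effdom n g" using w(1) by (simp add: effdom_def cube_def)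
qed

definition ball_optimal :: "nat \<Rightarrow> (point \<Rightarrow> ereal) \<Rightarrow> point \<Rightarrow> int \<Rightarrow> point \<Rightarrow> bool" where
  "ball_optimal n g c k y \<longleftrightarrow> y \<in> effdom n g \<and> y \<in> cube n c k \<and> (\<forall>w\<in>cube n c k. g y \<le> g w)"

text \<open>
  The iterates stay optimal in the growing balls. If the value does not drop, the old iterate is optimal
  in its 1-neighbourhood, which is contained in the ball of radius \<open>k\<close>.
\<close>

lemma descent_step:
  assumes orc: "two_nbhd_oracle n m orc" and g: "locally_dmc n g"
    and y: "ball_optimal n g c (k - 1) y" and k: "1 \<le> k"
  shows "ball_optimal n g c k (answer g (orc y (cube n c k)))"
    "evals g (orc y (cube n c k)) \<le> m"
    "g (answer g (orc y (cube n c k))) = g y \<Longrightarrow> z \<in> Zn n \<Longrightarrow> g y \<le> g z"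
proof -
  let ?w = "answer g (orc y (cube n c k))"
  have y': "y \<in> effdom n g" "y \<in> cube n c (k - 1)" "\<And>w. w \<in> cube n c (k - 1) \<Longrightarrow> g y \<le> g w"
    using y by (auto simp: ball_optimal_def)
  have yk: "y \<in> cube n c k" using y'(2) by (simp add: cube_def)
  have "0 \<le> k" using k by simp
  note w = oracle_answer[OF orc g y'(1) yk \<open>0 \<le> k\<close>]
  show "evals g (orc y (cube n c k)) \<le> m" by (rule w(4))
  have "g ?w \<le> g z" if "z \<in> cube n c k" for z
  proof -
    obtain v where "v \<in> cube n y 2" "v \<in> cube n c k" "g v \<le> g z"
      using ball_cube_step[OF g k y' \<open>z \<in> cube n c k\<close>] by blast
    then show ?thesis using w(5) order_trans by blast
  qed
  then show "ball_optimal n g c k ?w" using w(1,3) by (simp add: ball_optimal_def)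
  show "g y \<le> g z" if eq: "g ?w = g y" and "z \<in> Zn n"
  proof (rule local_minimum_is_global[OF g y'(1) _ \<open>z \<in> Zn n\<close>])
    fix v assume v: "v \<in> cube n y 1"
    have "\<bar>v i - c i\<bar> \<le> k" if "i < n" for i
    proof -
      have "\<bar>v i - y i\<bar> \<le> 1" using v that by (simp add: cube_iff)
      moreover have "\<bar>y i - c i\<bar> \<le> k - 1" using y'(2) that k by (simp add: cube_iff)
      ultimately show ?thesis by linarith
    qed
    moreover have "v \<in> Zn n" using v by (simp add: cube_def)
    ultimately have "v \<in> cube n c k" using k by (simp add: cube_iff)
    moreover have "v \<in> cube n y 2" using v by (simp add: cube_def)
    ultimately show "g y \<le> g v" using w(5) eq by metis
  qed
qed

lemma ball_optimal_global:
  assumes "ball_optimal n g (\<lambda>_. 0) k y" "int n \<le> k"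
    and box: "\<forall>z. g z < \<infinity> \<longrightarrow> linf n z \<le> int n" and "z \<in> Zn n"
  shows "g y \<le> g z"
proof (cases "g z < \<infinity>")
  case True
  have "z - (\<lambda>_. 0) = z" by (simp add: fun_eq_iff)
  moreover have "linf n z \<le> k" using box True assms(2) order_trans by blast
  ultimately have "z \<in> cube n (\<lambda>_. 0) k" using assms(4) by (simp add: cube_def)
  then show ?thesis using assms(1) by (simp add: ball_optimal_def)
qed simp

text \<open>
  Once the ball covers the box to which \<open>g\<close> is restricted, the iterate is a global minimizer and the next
  test succeeds. So the loop continues only while \<open>k \<le> n\<close>, and \<open>Suc (n + 1 - k)\<close>, with truncated
  subtraction, bounds the number of its remaining passes.
\<close>

lemma descent_loop_correct:
  assumes orc: "two_nbhd_oracle n m orc" and g: "locally_dmc n g"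
    and box: "\<forall>z. g z < \<infinity> \<longrightarrow> linf n z \<le> int n"
    and "descent_loop n orc g (\<lambda>_. 0) k y z N" "1 \<le> k" "ball_optimal n g (\<lambda>_. 0) (int k - 1) y"
  shows "z \<in> effdom n g \<and> (\<forall>w\<in>Zn n. g z \<le> g w) \<and> N \<le> Suc (n + 1 - k) * (m + 2)"
  using assms(4-)
proof (induction rule: descent_loop.induct)
  case (stop y' y k)
  have k: "1 \<le> int k" using stop.prems by simp
  note step = descent_step[OF orc g stop.prems(2) k]
  have "\<forall>w\<in>Zn n. g y \<le> g w" using step(3) stop.hyps by metis
  moreover have "y \<in> effdom n g" using stop.prems by (simp add: ball_optimal_def)
  moreover have "evals g (orc y (cube n (\<lambda>_. 0) (int k))) + 2 \<le> Suc (n + 1 - k) * (m + 2)"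
    using step(2) by simp
  ultimately show ?case by blast
next
  case (continue y' y k z N)
  have k: "1 \<le> int k" using continue.prems by simp
  note step = descent_step[OF orc g continue.prems(2) k]
  have "k \<le> n"
  proof (rule ccontr)
    assume "\<not> k \<le> n"
    then have "int n \<le> int k - 1" by simp
    then have "g y \<le> g y'"
      using ball_optimal_global[OF continue.prems(2) _ box] step(1) continue.hyps(1)
      by (simp add: ball_optimal_def effdom_def)
    moreover have "g y' \<le> g y"
      using step(1) continue.prems(2) continue.hyps(1) by (simp add: ball_optimal_def cube_def)
    ultimately show False using continue.hyps(2) by simp
  qed
  have rest: "z \<in> effdom n g \<and> (\<forall>w\<in>Zn n. g z \<le> g w) \<and> N \<le> Suc (n + 1 - (k + 1)) * (m + 2)"
    using step(1) continue.hyps(1) by (intro continue.IH) simp_all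
  have "n + 1 - k = Suc (n + 1 - (k + 1))" using \<open>k \<le> n\<close> by simp
  then have "Suc (n + 1 - k) * (m + 2) = (m + 2) + Suc (n + 1 - (k + 1)) * (m + 2)"
    by (simp only: mult_Suc)
  then show ?case using step(2) rest by linarith
qed

lemma descent_loop_terminates:
  assumes orc: "two_nbhd_oracle n m orc" and g: "locally_dmc n g"
    and box: "\<forall>z. g z < \<infinity> \<longrightarrow> linf n z \<le> int n"
    and "1 \<le> k" "ball_optimal n g (\<lambda>_. 0) (int k - 1) y"
  shows "\<exists>z N. descent_loop n orc g (\<lambda>_. 0) k y z N"
  using assms(4-)
proof (induction "n + 1 - k" arbitrary: k y rule: less_induct)
  case less
  have k: "1 \<le> int k" using less.prems by simp
  note step = descent_step[OF orc g less.prems(2) k]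
  define y' where "y' = answer g (orc y (cube n (\<lambda>_. 0) (int k)))"
  show ?case
  proof (cases "g y' = g y")
    case True
    with y'_def have "descent_loop n orc g (\<lambda>_. 0) k y y
        (evals g (orc y (cube n (\<lambda>_. 0) (int k))) + 2)" by (rule descent_loop.stop)
    then show ?thesis by blast
  next
    case False
    have "k \<le> n"
    proof (rule ccontr)
      assume "\<not> k \<le> n"
      then have "int n \<le> int k - 1" by simp
      then have "g y \<le> g y'"
        using ball_optimal_global[OF less.prems(2) _ box] step(1) y'_def
        by (simp add: ball_optimal_def effdom_def)
      moreover have "g y' \<le> g y"
        using step(1) less.prems(2) y'_def by (simp add: ball_optimal_def cube_def)
      ultimately show False using False by simp
    qed
    have "\<exists>z N. descent_loop n orc g (\<lambda>_. 0) (k + 1) y' z N"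
    proof (rule less.hyps)
      show "n + 1 - (k + 1) < n + 1 - k" using \<open>k \<le> n\<close> by simp
      show "ball_optimal n g (\<lambda>_. 0) (int (k + 1) - 1) y'" using step(1) by (simp add: y'_def)
    qed simp
    then obtain z N where "descent_loop n orc g (\<lambda>_. 0) (k + 1) y' z N" by blast
    with y'_def False have "descent_loop n orc g (\<lambda>_. 0) k y z
        (evals g (orc y (cube n (\<lambda>_. 0) (int k))) + 2 + N)" by (rule descent_loop.continue)
    then show ?thesis by blast
  qed
qed

lemma steepest_descent_correct:
  assumes orc: "two_nbhd_oracle n m orc" and g: "locally_dmc n g"
    and box: "\<forall>z. g z < \<infinity> \<longrightarrow> linf n z \<le> int n"
    and zero: "(\<lambda>_. 0) \<in> effdom n g" and "1 \<le> n" "1 \<le> m"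
  shows "\<exists>z N. steepest_descent n orc g (\<lambda>_. 0) z N"
    and "steepest_descent n orc g (\<lambda>_. 0) z N \<Longrightarrow>
      z \<in> effdom n g \<and> (\<forall>w\<in>Zn n. g z \<le> g w) \<and> N \<le> 4 * n * m"
proof -
  define y where "y = answer g (orc (\<lambda>_. 0) (cube n (\<lambda>_. 0) 2))"
  have "(\<lambda>_. 0) \<in> cube n (\<lambda>_. 0) 2" by (rule center_in_cube) (auto simp: Zn_def)
  note w = oracle_answer[OF orc g zero this, folded y_def]
  have opt: "ball_optimal n g (\<lambda>_. 0) (int 3 - 1) y"
    using w by (simp add: ball_optimal_def)
  show "\<exists>z N. steepest_descent n orc g (\<lambda>_. 0) z N"
    using descent_loop_terminates[OF orc g box _ opt] unfolding steepest_descent_def y_def by auto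
  assume "steepest_descent n orc g (\<lambda>_. 0) z N"
  then obtain N' where N': "descent_loop n orc g (\<lambda>_. 0) 3 y z N'"
      "N = evals g (orc (\<lambda>_. 0) (cube n (\<lambda>_. 0) 2)) + N'"
    unfolding steepest_descent_def y_def by blast
  have z: "z \<in> effdom n g \<and> (\<forall>w\<in>Zn n. g z \<le> g w) \<and> N' \<le> Suc (n + 1 - 3) * (m + 2)"
    using descent_loop_correct[OF orc g box N'(1) _ opt] by simp
  \<comment> \<open>The loop starts with \<open>k = 3\<close>. For \<open>n \<ge> 1\<close> its \<open>Suc (n - 2)\<close> passes are at most \<open>n\<close>, and each
    costs \<open>m + 2 \<le> 3 m\<close> evaluations.\<close>
  have "N \<le> m + Suc (n + 1 - 3) * (m + 2)" using N'(2) z w(4) by simp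
  also have "\<dots> \<le> m + n * (3 * m)"
    using assms(5,6) by (intro add_left_mono mult_mono) auto
  also have "\<dots> \<le> 4 * n * m" using assms(5) by simp
  finally show "z \<in> effdom n g \<and> (\<forall>w\<in>Zn n. g z \<le> g w) \<and> N \<le> 4 * n * m" using z by blast
qed


section \<open>The scaling algorithm\<close>

lemma finite_effdom:
  assumes "bounded_effdom n f"
  shows "finite (effdom n f)"
proof -
  obtain B where B: "\<And>x. x \<in> effdom n f \<Longrightarrow> linf n x \<le> B" using assms by (auto simp: bounded_effdom_def)
  have "effdom n f \<subseteq> {x. \<forall>i. (i \<in> {..<n} \<longrightarrow> x i \<in> {-B..B}) \<and> (i \<notin> {..<n} \<longrightarrow> x i = 0)}"
  proof
    fix x assume x: "x \<in> effdom n f"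
    have "\<bar>x i\<bar> \<le> B" if "i < n" for i using abs_le_linf[OF that, of x] B[OF x] by simp
    then have "x i \<in> {-B..B}" if "i < n" for i using that by (force simp: abs_le_iff)
    then show "x \<in> {x. \<forall>i. (i \<in> {..<n} \<longrightarrow> x i \<in> {-B..B}) \<and> (i \<notin> {..<n} \<longrightarrow> x i = 0)}"
      using x by (auto simp: effdom_def Zn_def)
  qed
  then show ?thesis by (rule finite_subset) (intro finite_set_of_finite_funs; simp)
qed

lemma linf_diff_le_Kinf:
  assumes "bounded_effdom n f" "x \<in> effdom n f" "y \<in> effdom n f"
  shows "linf n (x - y) \<le> Kinf n f"
proof -
  have "{linf n (x - y) |x y. x \<in> effdom n f \<and> y \<in> effdom n f}
      = (\<lambda>(x, y). linf n (x - y)) ` (effdom n f \<times> effdom n f)" by auto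
  then have "finite {linf n (x - y) |x y. x \<in> effdom n f \<and> y \<in> effdom n f}"
    using finite_effdom[OF assms(1)] by simp
  then show ?thesis unfolding Kinf_def using assms(2,3) by (intro Max_ge) auto
qed

lemma move_move: "move (move x \<alpha> y) \<alpha> z = move x \<alpha> (shift y z)"
  by (simp add: fun_eq_iff move_def shift_def algebra_simps)

text \<open>
  In the coordinates \<open>y\<close> with \<open>x + 2^t y\<close>, optimality of \<open>x\<close> at twice the current step size is the
  optimality of 0 among even vectors. By proximity the box of radius \<open>n\<close> then contains a minimizer of the
  scaled function on all of \<open>Z^n\<close>, so the minimizer found in the box is optimal at the current step size.
\<close>

lemma scaling_round:
  assumes orc: "two_nbhd_oracle n m orc" and f: "locally_dmc n f" and "bounded_effdom n f"
    and pos: "1 \<le> n" "1 \<le> m"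
    and x: "x \<in> effdom n f" "\<forall>y\<in>Zn n. f x \<le> f (move x (2 * 2 ^ t) y)"
  shows "\<exists>y N. steepest_descent n orc (scaled_fun n f x (2 ^ t)) (\<lambda>_. 0) y N"
    and "steepest_descent n orc (scaled_fun n f x (2 ^ t)) (\<lambda>_. 0) y N \<Longrightarrow>
      move x (2 ^ t) y \<in> effdom n f \<and>
      (\<forall>w\<in>Zn n. f (move x (2 ^ t) y) \<le> f (move (move x (2 ^ t) y) (2 ^ t) w)) \<and> N \<le> 4 * n * m"
proof -
  define h where "h y = f (move x (2 ^ t) y)" for y
  define g where "g = scaled_fun n f x (2 ^ t)"
  have g_eq: "g = (\<lambda>y. if linf n y \<le> int n then h y else \<infinity>)"
    by (simp add: fun_eq_iff g_def h_def scaled_fun_def)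
  have xZ: "x \<in> Zn n" using x(1) effdom_Zn by blast
  have h: "locally_dmc n h" using locally_dmc_move[OF f xZ, of t] by (simp add: h_def[abs_def])
  have g: "locally_dmc n g" using locally_dmc_restrict_box[OF h, of n] by (simp add: g_eq)
  have box: "\<forall>z. g z < \<infinity> \<longrightarrow> linf n z \<le> int n" by (simp add: g_eq)
  have h0: "h (\<lambda>_. 0) = f x" by (simp add: h_def move_def)
  have zero: "(\<lambda>_. 0) \<in> effdom n h" using x(1) by (simp add: effdom_def h0 Zn_def)
  have "linf n (\<lambda>_. 0) \<le> int n" by (subst linf_le_iff) auto
  then have zero_g: "(\<lambda>_. 0) \<in> effdom n g" using zero by (simp add: g_eq effdom_def)
  note descent = steepest_descent_correct[OF orc g box zero_g pos]
  show "\<exists>y N. steepest_descent n orc (scaled_fun n f x (2 ^ t)) (\<lambda>_. 0) y N"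
    using descent(1) by (simp add: g_def)
  assume "steepest_descent n orc (scaled_fun n f x (2 ^ t)) (\<lambda>_. 0) y N"
  then have y: "y \<in> effdom n g" "\<And>w. w \<in> Zn n \<Longrightarrow> g y \<le> g w" "N \<le> 4 * n * m"
    using descent(2) by (simp_all add: g_def)
  have yZ: "y \<in> Zn n" using y(1) effdom_Zn by blast
  have "g y < \<infinity>" using y(1) by (simp add: effdom_def)
  then have "linf n y \<le> int n" using box by blast
  then have gy: "g y = h y" by (simp add: g_eq)
  have fin: "finite (effdom n h)"
  proof -
    have "inj (move x (2 ^ t))" by (auto simp: inj_def move_def fun_eq_iff)
    moreover have "effdom n h \<subseteq> move x (2 ^ t) -` effdom n f"
      using move_in_Zn[OF xZ] by (auto simp: effdom_def h_def)
    ultimately show ?thesis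
      by (rule finite_subset[OF _ finite_vimageI[OF finite_effdom[OF assms(3)]], rotated])
  qed
  have even: "h (\<lambda>_. 0) \<le> h (\<lambda>i. 2 * w i)" if "w \<in> Zn n" for w
  proof -
    have "move x (2 ^ t) (\<lambda>i. 2 * w i) = move x (2 * 2 ^ t) w" by (simp add: fun_eq_iff move_def)
    then show ?thesis using x(2) that by (simp add: h_def h0[unfolded h_def])
  qed
  obtain z where z: "z \<in> effdom n h" "linf n z \<le> int n" "\<And>w. w \<in> Zn n \<Longrightarrow> h z \<le> h w"
    using scaling_proximity[OF h fin zero even] by blast
  have "h y \<le> h w" if "w \<in> Zn n" for w
  proof -
    have "h y = g y" by (simp add: gy)
    also have "\<dots> \<le> g z" using z(1) y(2) by (simp add: effdom_def)
    also have "g z = h z" using z(2) by (simp add: g_eq)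
    also have "h z \<le> h w" by (rule z(3)[OF that])
    finally show ?thesis .
  qed
  then have "\<forall>w\<in>Zn n. f (move x (2 ^ t) y) \<le> f (move (move x (2 ^ t) y) (2 ^ t) w)"
    using shift_in_Zn[OF yZ] by (simp add: h_def move_move)
  moreover have "move x (2 ^ t) y \<in> effdom n f"
    using y(1) gy move_in_Zn[OF xZ yZ] by (simp add: effdom_def h_def)
  ultimately show "move x (2 ^ t) y \<in> effdom n f \<and>
      (\<forall>w\<in>Zn n. f (move x (2 ^ t) y) \<le> f (move (move x (2 ^ t) y) (2 ^ t) w)) \<and> N \<le> 4 * n * m"
    using y(3) by blast
qed

text \<open>
  The invariant is that \<open>x\<close> is optimal at twice the current step size. At step size 1 the result of a
  round is optimal on \<open>Z^n\<close>.
\<close>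

lemma scaling_loop_correct:
  assumes orc: "two_nbhd_oracle n m orc" and f: "locally_dmc n f" and bd: "bounded_effdom n f"
    and pos: "1 \<le> n" "1 \<le> m"
    and "x \<in> effdom n f" "\<forall>y\<in>Zn n. f x \<le> f (move x (2 * 2 ^ t) y)"
  shows "(\<exists>z N. scaling_loop n orc f x (2 ^ t) z N) \<and>
    (\<forall>z N. scaling_loop n orc f x (2 ^ t) z N \<longrightarrow>
       z \<in> Zn n \<and> (\<forall>w\<in>Zn n. f z \<le> f w) \<and> N \<le> Suc t * (4 * n * m))"
  using assms(6-)
proof (induction t arbitrary: x)
  case 0
  note round = scaling_round[OF orc f bd pos 0]
  have one: "(2::int) ^ 0 = 1" by simp
  obtain y N where "steepest_descent n orc (scaled_fun n f x (2 ^ 0)) (\<lambda>_. 0) y N"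
    using round(1) by blast
  then have ex: "\<exists>z N. scaling_loop n orc f x (2 ^ 0) z N" using scaling_loop.stop[OF one] by blast
  have "z \<in> Zn n \<and> (\<forall>w\<in>Zn n. f z \<le> f w) \<and> N \<le> Suc 0 * (4 * n * m)"
    if "scaling_loop n orc f x (2 ^ 0) z N" for z N
    using that
  proof cases
    case (stop y)
    have *: "move x (2 ^ 0) y \<in> effdom n f" "N \<le> 4 * n * m"
      "\<And>w. w \<in> Zn n \<Longrightarrow> f (move x (2 ^ 0) y) \<le> f (move (move x (2 ^ 0) y) (2 ^ 0) w)"
      using round(2)[OF stop(3)] by blast+
    have zZ: "z \<in> Zn n" using *(1) stop(1) effdom_Zn by blast
    have "f z \<le> f w" if "w \<in> Zn n" for w
    proof -
      have "move z 1 (w - z) = w" by (simp add: fun_eq_iff move_def)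
      then show ?thesis using *(3)[OF diff_in_Zn[OF zZ that]] stop(1) by simp
    qed
    then show ?thesis using zZ *(2) by simp
  next
    case continue
    then show ?thesis by simp
  qed
  with ex show ?case by blast
next
  case (Suc t)
  note round = scaling_round[OF orc f bd pos Suc.prems]
  have not1: "(2::int) ^ Suc t \<noteq> 1" using one_less_power[of "2::int" "Suc t"] by linarith
  have half: "(2::int) ^ Suc t div 2 = 2 ^ t" by simp
  have IH: "(\<exists>z N. scaling_loop n orc f (move x (2 ^ Suc t) y) (2 ^ t) z N) \<and>
    (\<forall>z N. scaling_loop n orc f (move x (2 ^ Suc t) y) (2 ^ t) z N \<longrightarrow>
       z \<in> Zn n \<and> (\<forall>w\<in>Zn n. f z \<le> f w) \<and> N \<le> Suc t * (4 * n * m))"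
    if "steepest_descent n orc (scaled_fun n f x (2 ^ Suc t)) (\<lambda>_. 0) y M" for y M
    using round(2)[OF that] by (intro Suc.IH) simp_all
  obtain y M where y: "steepest_descent n orc (scaled_fun n f x (2 ^ Suc t)) (\<lambda>_. 0) y M"
    using round(1) by blast
  then have ex: "\<exists>z N. scaling_loop n orc f x (2 ^ Suc t) z N"
    using scaling_loop.continue[OF not1 y] IH[OF y] unfolding half by blast
  have "z \<in> Zn n \<and> (\<forall>w\<in>Zn n. f z \<le> f w) \<and> N \<le> Suc (Suc t) * (4 * n * m)"
    if "scaling_loop n orc f x (2 ^ Suc t) z N" for z N
    using that
  proof cases
    case stop
    then show ?thesis using not1 by simp
  next
    case (continue y M N')
    have "M \<le> 4 * n * m" using round(2)[OF continue(3)] by blast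
    moreover have "z \<in> Zn n \<and> (\<forall>w\<in>Zn n. f z \<le> f w) \<and> N' \<le> Suc t * (4 * n * m)"
      using IH[OF continue(3)] continue(4) unfolding half by blast
    moreover have "Suc (Suc t) * (4 * n * m) = 4 * n * m + Suc t * (4 * n * m)"
      by (rule mult_Suc)
    ultimately show ?thesis using continue(1) by linarith
  qed
  with ex show ?case by blast
qed

text \<open>
  The number of rounds is at most \<open>log (K + 1) + 2 \<le> log K + 3\<close>, and \<open>log K \<ge> 1\<close>.
\<close>

lemma log_rounds:
  assumes "2 \<le> K"
  shows "real (Suc (nat \<lceil>log 2 (real_of_int (K + 1))\<rceil>)) \<le> 4 * log 2 (real_of_int K)"
proof -
  have "1 = log 2 (2::real)" by simp
  also have "\<dots> \<le> log 2 (real_of_int K)" using assms by (subst log_le_cancel_iff) auto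
  finally have 1: "1 \<le> log 2 (real_of_int K)" .
  have "log 2 (real_of_int (K + 1)) \<le> log 2 (2 * real_of_int K)"
    using assms by (subst log_le_cancel_iff) auto
  also have "\<dots> = 1 + log 2 (real_of_int K)" using assms by (subst log_mult) auto
  finally have 2: "log 2 (real_of_int (K + 1)) \<le> 1 + log 2 (real_of_int K)" .
  have "0 \<le> log 2 (real_of_int (K + 1))" using assms by simp
  then have "real (nat \<lceil>log 2 (real_of_int (K + 1))\<rceil>) \<le> log 2 (real_of_int (K + 1)) + 1"
    by (simp add: of_nat_nat)
  with 1 2 show ?thesis by simp
qed

lemma less_two_power_log:
  assumes "0 < K"
  shows "K < 2 ^ nat \<lceil>log 2 (real_of_int (K + 1))\<rceil>"
proof -
  define T where "T = nat \<lceil>log 2 (real_of_int (K + 1))\<rceil>"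
  have "log 2 (real_of_int (K + 1)) \<le> real T" by (simp add: T_def real_nat_ceiling_ge)
  then have "real_of_int (K + 1) \<le> 2 powr real T" using assms by (simp add: log_le_iff)
  also have "\<dots> = real_of_int (2 ^ T)" by (simp add: powr_realpow)
  finally have "K + 1 \<le> 2 ^ T" by linarith
  then show ?thesis by (simp add: T_def)
qed

lemma scaling_algorithm_correct:
  assumes orc: "two_nbhd_oracle n m orc" and f: "locally_dmc n f" and bd: "bounded_effdom n f"
    and m: "1 \<le> m" and x: "x \<in> effdom n f" and K: "0 < Kinf n f"
  shows "\<exists>z N. scaling_algorithm n orc f x z N"
    and "scaling_algorithm n orc f x z N \<Longrightarrow> is_arg_min f (\<lambda>y. y \<in> Zn n) z \<and>
      (2 \<le> Kinf n f \<longrightarrow> real N \<le> 16 * real n * real m * log 2 (real_of_int (Kinf n f)))"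
proof -
  define T where "T = nat \<lceil>log 2 (real_of_int (Kinf n f + 1))\<rceil>"
  have xZ: "x \<in> Zn n" using x effdom_Zn by blast
  have n: "1 \<le> n"
  proof (rule ccontr)
    assume "\<not> 1 \<le> n"
    then have "n = 0" by simp
    then have "linf n w = 0" for w by (simp add: linf_def)
    then have "{linf n (x - y) |x y. x \<in> effdom n f \<and> y \<in> effdom n f} = {0}"
      using x by auto
    then show False using K by (simp add: Kinf_def)
  qed
  \<comment> \<open>The invariant holds initially because every other point at this step size is further than
    \<open>K\<close> from \<open>x\<close>, hence outside the effective domain.\<close>
  have far: "\<forall>y\<in>Zn n. f x \<le> f (move x (2 * 2 ^ T) y)"
  proof
    fix y assume y: "y \<in> Zn n"
    show "f x \<le> f (move x (2 * 2 ^ T) y)"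
    proof (cases "y = (\<lambda>_. 0)")
      case True
      then show ?thesis by (simp add: move_def)
    next
      case False
      have "f (move x (2 * 2 ^ T) y) = \<infinity>"
      proof (rule ccontr)
        assume "f (move x (2 * 2 ^ T) y) \<noteq> \<infinity>"
        then have dom: "move x (2 * 2 ^ T) y \<in> effdom n f"
          using move_in_Zn[OF xZ y] by (simp add: effdom_def less_top)
        obtain i where i: "y i \<noteq> 0" using False by auto
        have "i < n"
        proof (rule ccontr)
          assume "\<not> i < n"
          then show False using y i by (simp add: Zn_def)
        qed
        then have "\<bar>(move x (2 * 2 ^ T) y - x) i\<bar> \<le> Kinf n f"
          using abs_le_linf linf_diff_le_Kinf[OF bd dom x] order_trans by blast
        moreover have "\<bar>(move x (2 * 2 ^ T) y - x) i\<bar> = 2 * 2 ^ T * \<bar>y i\<bar>"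
          by (simp add: move_def abs_mult)
        moreover have "2 * 2 ^ T * 1 \<le> 2 * 2 ^ T * \<bar>y i\<bar>" using i by (intro mult_left_mono) auto
        moreover have "Kinf n f < 2 ^ T" unfolding T_def by (rule less_two_power_log[OF K])
        ultimately show False using K by linarith
      qed
      then show ?thesis by simp
    qed
  qed
  note loop = scaling_loop_correct[OF orc f bd n m x far]
  show "\<exists>z N. scaling_algorithm n orc f x z N"
    using loop by (simp add: scaling_algorithm_def T_def)
  assume "scaling_algorithm n orc f x z N"
  then have z: "z \<in> Zn n" "\<And>w. w \<in> Zn n \<Longrightarrow> f z \<le> f w" "N \<le> Suc T * (4 * n * m)"
    using loop by (simp_all add: scaling_algorithm_def T_def)
  have "real N \<le> 16 * real n * real m * log 2 (real_of_int (Kinf n f))" if "2 \<le> Kinf n f"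
  proof -
    have "real N \<le> real (Suc T * (4 * n * m))" using z(3) by (rule of_nat_mono)
    also have "\<dots> = real (Suc T) * (4 * real n * real m)" by (simp only: of_nat_mult of_nat_numeral)
    also have "\<dots> \<le> (4 * log 2 (real_of_int (Kinf n f))) * (4 * real n * real m)"
      using log_rounds[OF that] unfolding T_def by (intro mult_right_mono) auto
    finally show ?thesis by (simp add: mult_ac)
  qed
  then show "is_arg_min f (\<lambda>y. y \<in> Zn n) z \<and>
      (2 \<le> Kinf n f \<longrightarrow> real N \<le> 16 * real n * real m * log 2 (real_of_int (Kinf n f)))"
    using z(1,2) by (auto simp: is_arg_min_linorder)
qed

theorem theorem6p3:
  "\<exists>C::real. \<forall>(n::nat) (F :: nat \<Rightarrow> nat) (orc :: nbhd_oracle) (f :: point \<Rightarrow> ereal) (x0 :: point).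
     F n \<ge> 1 \<and> two_nbhd_oracle n (F n) orc \<and>
     (locally_dmc n f \<or> globally_dmc n f) \<and> bounded_effdom n f \<and>
     x0 \<in> effdom n f \<and> Kinf n f > 0 \<longrightarrow>
       (\<exists>z N. scaling_algorithm n orc f x0 z N) \<and>
       (\<forall>z N. scaling_algorithm n orc f x0 z N \<longrightarrow>
          is_arg_min f (\<lambda>y. y \<in> Zn n) z \<and>
          (Kinf n f \<ge> 2 \<longrightarrow>
             real N \<le> C * real n * real (F n) * log 2 (real_of_int (Kinf n f))))"
proof (intro exI[of _ 16] allI impI)
  fix n :: nat and F :: "nat \<Rightarrow> nat" and orc f x0
  assume *: "F n \<ge> 1 \<and> two_nbhd_oracle n (F n) orc \<and>
     (locally_dmc n f \<or> globally_dmc n f) \<and> bounded_effdom n f \<and> x0 \<in> effdom n f \<and> Kinf n f > 0"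
  then have f: "locally_dmc n f" using globally_imp_locally_dmc by blast
  show "(\<exists>z N. scaling_algorithm n orc f x0 z N) \<and>
       (\<forall>z N. scaling_algorithm n orc f x0 z N \<longrightarrow>
          is_arg_min f (\<lambda>y. y \<in> Zn n) z \<and>
          (Kinf n f \<ge> 2 \<longrightarrow>
             real N \<le> 16 * real n * real (F n) * log 2 (real_of_int (Kinf n f))))"
    using scaling_algorithm_correct[OF _ f, of "F n" orc x0] * by blast
qed

end
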